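(* Let $f=\frac1n\sum_{i=1}^n f_i$ on $\mathbb{R}^d$ satisfy assumptions A1 (each $f_i$ is differentiable, convex, and $f_i(x)-f_i(y)-\langle\nabla f_i(y),x-y\rangle\le\frac L2\|x-y\|_2^2$ for all $x,y$) and A2 ($f(x)-f(x^* )\ge\frac\mu2\|x-x^*\|_2^2$ for all $x$, for some $\mu\ge0$). Fix constants $\alpha>1$, $m_0>0$, $\xi\in(0,1)$, and run the SCSG algorithm (described in the context) with $$\eta_j\equiv\eta,\qquad b_j\equiv b,\qquad m_j=m_0\alpha^j,\qquad B_j=\lceil B_0\alpha^{2j}\wedge n\rceil .$$ Put $\Gamma=\frac{1}{4\alpha^{1/\xi}}$ and assume $$m_0\ge b/\Gamma,\qquad 2\eta L\le\min\{1-\Gamma,\;2\Gamma b,\;\Gamma^2 bB_0/m_0\}.$$ Let $T_\kappa^*,T_n^*$ be the positive numbers with $$\alpha^{T_\kappa^*}=\frac1{\eta\mu},\qquad B_0\alpha^{2T_n^*}=n$$ ($T_\kappa^*=\infty$ if $\mu=0$), and let $$\lambda_j=\begin{cases}\alpha & (j\le T_\kappa^* )\\ \alpha^{1/\xi}&(j>T_\kappa^* )\end{cases},\qquad \tilde\lambda_j=\begin{cases}\alpha & (j\le T_n^*\vee T_\kappa^* )\\ \alpha^{1/\xi}&(j>T_n^*\vee T_\kappa^* )\end{cases},$$ $\Lambda_T=\lambda_T\lambda_{T-1}\cdots\lambda_1$, $\tilde\Lambda_T=\tilde\lambda_T\tilde\lambda_{T-1}\cdots\tilde\lambda_1$. Then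 $$\mathbb{E}\big(f(\tilde x_T)-f(x^* )\big)\le\Lambda_T^{-1}\frac{D_x}{2\eta L}+\tilde\Lambda_T^{-1}\,\frac{2\eta Lm_0}{\Gamma bB_0}\,D_H\,(T\wedge T_n^* ).$$
   Context: Notation: $a\wedge b=\min\{a,b\}$, $a\vee b=\max\{a,b\}$. $L\in(0,\infty)$; $x^*$ is a minimizer of $f$ (if there are several, one minimizing $\mathcal H$ below). Define $\mathcal H=\frac1n\sum_{i=1}^n\|\nabla f_i(x^* )\|_2^2$, $D_x=L\,\mathbb{E}\|\tilde x_0-x^*\|_2^2$, $D_H=\mathcal H/L$. For $\mathcal I\subset\{1,\dots,n\}$, $\nabla f_{\mathcal I}(x)=\frac1{|\mathcal I|}\sum_{i\in\mathcal I}\nabla f_i(x)$. $N\sim\mathrm{Geom}(\gamma)$ means $P(N=k)=(1-\gamma)\gamma^k$, $k=0,1,2,\dots$. SCSG algorithm. Inputs: initial (possibly random) iterate $\tilde x_0$, stepsizes $\eta_j>0$, batch sizes $B_j\in\{1,\dots,n\}$, inner loop sizes $m_j>0$, mini-batch sizes $b_j\in\{1,\dots,n\}$. For $j=1,2,\dots,T$: draw a uniformly random subset $\mathcal I_j\subset\{1,\dots,n\}$ of size $B_j$; set $\mu_j=\nabla f_{\mathcal I_j}(\tilde x_{j-1})$ and $x^{(j)}_0=\tilde x_{j-1}$; draw $N_j\sim\mathrm{Geom}\big(\frac{m_j}{m_j+b_j}\big)$; for $k=1,\dots,N_j$, draw a uniformly random subset $\tilde{\mathcal I}^{(j)}_{k-1}$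 of size $b_j$, set $\nu^{(j)}_{k-1}=\nabla f_{\tilde{\mathcal I}^{(j)}_{k-1}}(x^{(j)}_{k-1})-\nabla f_{\tilde{\mathcal I}^{(j)}_{k-1}}(x^{(j)}_0)+\mu_j$ and $x^{(j)}_k=x^{(j)}_{k-1}-\eta_j\nu^{(j)}_{k-1}$; set $\tilde x_j=x^{(j)}_{N_j}$. All random draws are mutually independent and independent of $\tilde x_0$. *)

theory Defs
  imports "HOL-Probability.Probability"
begin

section \<open>Finite-sum objective\<close>

text \<open>The summands \<open>f\<^sub>1, \<dots>, f\<^sub>n\<close> are \<open>f 1, \<dots>, f n\<close>; values of \<open>f\<close> at other indices are irrelevant.\<close>

definition grad :: "('a::euclidean_space \<Rightarrow> real) \<Rightarrow> 'a \<Rightarrow> 'a" where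
  "grad h x = (THE D. GDERIV h x :> D)"

definition objective :: "(nat \<Rightarrow> 'a \<Rightarrow> real) \<Rightarrow> nat \<Rightarrow> 'a \<Rightarrow> real" where
  "objective f n x = (\<Sum>i=1..n. f i x) / real n"

definition batch_grad :: "(nat \<Rightarrow> 'a::euclidean_space \<Rightarrow> real) \<Rightarrow> nat set \<Rightarrow> 'a \<Rightarrow> 'a" where
  "batch_grad f S x = (1 / real (card S)) *\<^sub>R (\<Sum>i\<in>S. grad (f i) x)"

definition grad_second_moment :: "(nat \<Rightarrow> 'a::euclidean_space \<Rightarrow> real) \<Rightarrow> nat \<Rightarrow> 'a \<Rightarrow> real" where
  "grad_second_moment f n x = (\<Sum>i=1..n. (norm (grad (f i) x))\<^sup>2) / real n"

definition reference_minimizer :: "(nat \<Rightarrow> 'a::euclidean_space \<Rightarrow> real) \<Rightarrow> nat \<Rightarrow> 'a \<Rightarrow> bool" where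
  "reference_minimizer f n xs \<longleftrightarrow>
     is_arg_min (grad_second_moment f n) (is_arg_min (objective f n) (\<lambda>_. True)) xs"

definition assumption_A1 :: "(nat \<Rightarrow> 'a::euclidean_space \<Rightarrow> real) \<Rightarrow> nat \<Rightarrow> real \<Rightarrow> bool" where
  "assumption_A1 f n L \<longleftrightarrow>
     (\<forall>i\<in>{1..n}. (\<forall>x. f i differentiable (at x)) \<and> convex_on UNIV (f i) \<and>
        (\<forall>x y. f i x - f i y - grad (f i) y \<bullet> (x - y) \<le> L / 2 * (norm (x - y))\<^sup>2))"

definition assumption_A2 :: "(nat \<Rightarrow> 'a::euclidean_space \<Rightarrow> real) \<Rightarrow> nat \<Rightarrow> 'a \<Rightarrow> real \<Rightarrow> bool" where
  "assumption_A2 f n xs \<mu> \<longleftrightarrow>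
     (\<forall>x. objective f n x - objective f n xs \<ge> \<mu> / 2 * (norm (x - xs))\<^sup>2)"

section \<open>The SCSG iterates\<close>

text \<open>The recursions below are for fixed outcomes of the random draws: \<open>I j\<close> is the batch and
  \<open>N j\<close> the number of inner steps of epoch \<open>j\<close>, and \<open>J j k\<close> is the mini-batch used to pass
  from inner iterate \<open>k\<close> to inner iterate \<open>Suc k\<close>.\<close>

primrec scsg_inner ::
  "(nat \<Rightarrow> 'a::euclidean_space \<Rightarrow> real) \<Rightarrow> real \<Rightarrow> 'a \<Rightarrow> nat set \<Rightarrow> (nat \<Rightarrow> nat set) \<Rightarrow> nat \<Rightarrow> 'a" where
  "scsg_inner f \<eta> x S R 0 = x"
| "scsg_inner f \<eta> x S R (Suc k) =
     (let y = scsg_inner f \<eta> x S R k;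
          \<nu> = batch_grad f (R k) y - batch_grad f (R k) x + batch_grad f S x
      in y - \<eta> *\<^sub>R \<nu>)"

primrec scsg ::
  "(nat \<Rightarrow> 'a::euclidean_space \<Rightarrow> real) \<Rightarrow> (nat \<Rightarrow> real) \<Rightarrow> 'a \<Rightarrow> (nat \<Rightarrow> nat set) \<Rightarrow> (nat \<Rightarrow> nat) \<Rightarrow>
   (nat \<Rightarrow> nat \<Rightarrow> nat set) \<Rightarrow> nat \<Rightarrow> 'a" where
  "scsg f \<eta> x0 I N J 0 = x0"
| "scsg f \<eta> x0 I N J (Suc j) =
     scsg_inner f (\<eta> (Suc j)) (scsg f \<eta> x0 I N J j) (I (Suc j)) (J (Suc j)) (N (Suc j))"

section \<open>The random draws\<close>

definition has_pmf :: "'w measure \<Rightarrow> ('w \<Rightarrow> 'b) \<Rightarrow> 'b pmf \<Rightarrow> bool" where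
  "has_pmf M X p \<longleftrightarrow>
     X \<in> measurable M (count_space UNIV) \<and> distr M (count_space UNIV) X = measure_pmf p"

definition uniform_subset :: "nat \<Rightarrow> nat \<Rightarrow> nat set pmf" where
  "uniform_subset n k = pmf_of_set {S. S \<subseteq> {1..n} \<and> card S = k}"

text \<open>\<open>P(N = k) = (1 - \<gamma>) \<gamma> ^ k\<close>; the parameter of the library's \<open>geometric_pmf\<close> is the
  complementary probability.\<close>

definition Geom :: "real \<Rightarrow> nat pmf" where
  "Geom \<gamma> = geometric_pmf (1 - \<gamma>)"

text \<open>The draws take values in different types, so their mutual independence is stated for the
  sigma-algebras they generate, indexed by the following type.\<close>

datatype draw = Start | Batch nat | Steps nat | Mini nat nat

primrec draw_events ::
  "'w measure \<Rightarrow> ('w \<Rightarrow> 'a::euclidean_space) \<Rightarrow> (nat \<Rightarrow> 'w \<Rightarrow> nat set) \<Rightarrow> (nat \<Rightarrow> 'w \<Rightarrow> nat) \<Rightarrow>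
   (nat \<Rightarrow> nat \<Rightarrow> 'w \<Rightarrow> nat set) \<Rightarrow> draw \<Rightarrow> 'w set set" where
  "draw_events M X0 I N J Start = sets (vimage_algebra (space M) X0 borel)"
| "draw_events M X0 I N J (Batch j) = sets (vimage_algebra (space M) (I j) (count_space UNIV))"
| "draw_events M X0 I N J (Steps j) = sets (vimage_algebra (space M) (N j) (count_space UNIV))"
| "draw_events M X0 I N J (Mini j k) = sets (vimage_algebra (space M) (J j k) (count_space UNIV))"

definition draws_upto :: "nat \<Rightarrow> draw set" where
  "draws_upto T = {Start} \<union> Batch ` {1..T} \<union> Steps ` {1..T} \<union> {Mini j k | j k. j \<in> {1..T}}"

text \<open>Mini-batches are provided for all \<open>k\<close>, although epoch \<open>j\<close> only looks at those with
  \<open>k < N j\<close>; this does not affect the iterates.\<close>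

definition scsg_draws ::
  "'w measure \<Rightarrow> nat \<Rightarrow> (nat \<Rightarrow> nat) \<Rightarrow> (nat \<Rightarrow> real) \<Rightarrow> (nat \<Rightarrow> nat) \<Rightarrow> nat \<Rightarrow>
   ('w \<Rightarrow> 'a::euclidean_space) \<Rightarrow> (nat \<Rightarrow> 'w \<Rightarrow> nat set) \<Rightarrow> (nat \<Rightarrow> 'w \<Rightarrow> nat) \<Rightarrow>
   (nat \<Rightarrow> nat \<Rightarrow> 'w \<Rightarrow> nat set) \<Rightarrow> bool" where
  "scsg_draws M n B m b T X0 I N J \<longleftrightarrow>
     prob_space M \<and>
     X0 \<in> borel_measurable M \<and>
     (\<forall>j\<in>{1..T}. has_pmf M (I j) (uniform_subset n (B j))) \<and>
     (\<forall>j\<in>{1..T}. has_pmf M (N j) (Geom (m j / (m j + real (b j))))) \<and>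
     (\<forall>j\<in>{1..T}. \<forall>k. has_pmf M (J j k) (uniform_subset n (b j))) \<and>
     prob_space.indep_sets M (draw_events M X0 I N J) (draws_upto T)"

section \<open>Rates\<close>

text \<open>\<open>rate \<alpha> \<xi> \<tau> j\<close> is \<open>\<lambda>\<^sub>j\<close> for \<open>\<tau> = T\<^sub>\<kappa>\<^sup>*\<close>, and its tilde version for
  \<open>\<tau> = max T\<^sub>n\<^sup>* T\<^sub>\<kappa>\<^sup>*\<close>. The threshold is extended real, as \<open>T\<^sub>\<kappa>\<^sup>* = \<infinity>\<close> if \<open>\<mu> = 0\<close>.\<close>

definition rate :: "real \<Rightarrow> real \<Rightarrow> ereal \<Rightarrow> nat \<Rightarrow> real" where
  "rate \<alpha> \<xi> \<tau> j = (if ereal (real j) \<le> \<tau> then \<alpha> else \<alpha> powr (1 / \<xi>))"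

definition rate_prod :: "real \<Rightarrow> real \<Rightarrow> ereal \<Rightarrow> nat \<Rightarrow> real" where
  "rate_prod \<alpha> \<xi> \<tau> T = (\<Prod>j=1..T. rate \<alpha> \<xi> \<tau> j)"

end

theory Submission
  imports Defs
begin

text \<open>Write \<open>e\<close> for the error of the batch gradient of an epoch started at \<open>x\<close> and \<open>\<kappa> = b / m\<close>. One
  inner step from \<open>y\<close> is analysed through \<open>(1 - \<Gamma>) |y - x\<^sup>*|\<^sup>2 + \<Gamma> |y - x|\<^sup>2\<close>: co-coercivity of the
  gradients at \<open>x\<^sup>*\<close> and at \<open>x\<close> pays for the variance of the mini-batch, and the cross term of \<open>e\<close>
  with \<open>y - x\<close> is split by Young's inequality into a multiple of \<open>|e|\<^sup>2\<close> and \<open>\<kappa> \<Gamma> |y - x|\<^sup>2\<close>. The latter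
  is exactly what stopping the inner loop at a geometric time absorbs. The remaining term, the inner product
  of \<open>e\<close> with \<open>x - x\<^sup>*\<close>, vanishes on averaging over the batch. Hence each epoch contracts the
  Lyapunov function \<open>f - f(x\<^sup>*) + (1 - \<Gamma>) b / (2 \<eta> m\<^sub>j) |\<cdot> - x\<^sup>*|\<^sup>2\<close> by \<open>\<lambda>\<^sub>j\<close>, up to a noise
  proportional to \<open>\<alpha>\<^sup>-\<^sup>j\<close> that is present only for \<open>j < T\<^sub>n\<^sup>*\<close>.\<close>

section \<open>Gradients\<close>

text \<open>The value of \<open>\<Gamma>\<close> comes from four equal contributions. The tangent
  that links \<open>y\<close> to the start \<open>x\<close> of the epoch has weight
  \<open>\<Gamma>\<close> and costs \<open>\<Gamma>\<close> times the gap of \<open>x\<close>; the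
  part of the batch variance that is proportional to this gap costs \<open>2 * \<Gamma>\<close>;
  beyond \<open>T\<kappa>\<close> strong convexity turns the distance term into one more
  \<open>\<Gamma>\<close> times the gap. The total \<open>4 * \<Gamma>\<close> is the inverse of the
  fast rate \<open>\<alpha> powr (1 / \<xi>)\<close>. Two obstacles shape the argument. Given the
  batch, the error of an epoch has no sign, because of the inner product of \<open>e\<close> with
  \<open>x - xs\<close>; each epoch is therefore bounded for a fixed batch, and the bound is shown
  to be nonnegative, before the batch is averaged. Moreover the draws are arbitrary random variables
  on an abstract space, and the start may have an infinite second moment; so an epoch is replaced by
  a discrete law through its independence of the past, and the outer expectations are nonnegative
  integrals.\<close>

lemma GDERIV_grad:
  fixes h :: "'a::euclidean_space \<Rightarrow> real"
  assumes "h differentiable (at x)"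
  shows "GDERIV h x :> grad h x"
proof -
  obtain h' where h': "(h has_derivative h') (at x)"
    using assms by (auto simp: differentiable_def)
  have lin: "linear h'"
    using h' has_derivative_linear by blast
  \<comment> \<open>The Riesz representative of the derivative. As \<open>grad\<close> is a definite
    description, uniqueness has to be shown as well.\<close>
  define D where "D = (\<Sum>u\<in>Basis. h' u *\<^sub>R u)"
  have "h' v = v \<bullet> D" for v
  proof -
    have "h' v = h' (\<Sum>u\<in>Basis. (v \<bullet> u) *\<^sub>R u)"
      by (simp add: euclidean_representation)
    also have "\<dots> = (\<Sum>u\<in>Basis. (v \<bullet> u) * h' u)"
      using lin by (simp add: linear_sum linear_scale)
    also have "\<dots> = v \<bullet> D"
      by (simp add: D_def inner_sum_right mult.commute)
    finally show ?thesis .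
  qed
  then have D: "GDERIV h x :> D"
    using h' unfolding gderiv_def by (metis (no_types, lifting) ext)
  have "E = D" if "GDERIV h x :> E" for E
  proof -
    have "(\<lambda>v. v \<bullet> E) = (\<lambda>v. v \<bullet> D)"
      using has_derivative_unique that D unfolding gderiv_def by blast
    then have "v \<bullet> E = v \<bullet> D" for v
      by meson
    then show ?thesis
      using vector_eq_ldot by blast
  qed
  with D show ?thesis
    unfolding grad_def by (metis theI)
qed

text \<open>Restricting \<open>h\<close> to the line through \<open>y\<close> and \<open>x\<close>
  leaves a convex function of one real variable, whose tangent at 0 is evaluated at 1.\<close>

lemma convex_on_above_gradient:
  fixes h :: "'a::euclidean_space \<Rightarrow> real"
  assumes "convex_on UNIV h" and "GDERIV h y :> D"
  shows "h y + D \<bullet> (x - y) \<le> h x"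
proof -
  define \<phi> where "\<phi> t = h (y + t *\<^sub>R (x - y))" for t :: real
  have line: "y + ((1 - t) * r + t * s) *\<^sub>R (x - y)
      = (1 - t) *\<^sub>R (y + r *\<^sub>R (x - y)) + t *\<^sub>R (y + s *\<^sub>R (x - y))" for r s t :: real
    by (simp add: algebra_simps)
  have "convex_on UNIV \<phi>"
    using convex_onD[OF assms(1)] by (intro convex_onI) (auto simp: \<phi>_def line)
  moreover have "(\<phi> has_field_derivative D \<bullet> (x - y)) (at 0 within UNIV)"
  proof -
    have "((\<lambda>t. y + t *\<^sub>R (x - y)) has_derivative (\<lambda>t. t *\<^sub>R (x - y))) (at 0)"
      by (auto intro!: derivative_eq_intros)
    moreover have "(h has_derivative (\<lambda>v. v \<bullet> D)) (at (y + 0 *\<^sub>R (x - y)))"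
      using assms(2) by (simp add: gderiv_def)
    ultimately have "(\<phi> has_derivative (\<lambda>t. (t *\<^sub>R (x - y)) \<bullet> D)) (at 0)"
      unfolding \<phi>_def by (rule has_derivative_compose[where g = h])
    then show ?thesis
      by (simp add: has_field_derivative_def mult.commute inner_commute mult_commute_abs)
  qed
  ultimately have "D \<bullet> (x - y) * (1 - 0) \<le> \<phi> 1 - \<phi> 0"
    by (intro convex_on_imp_above_tangent[where A = UNIV]) auto
  then show ?thesis
    by (simp add: \<phi>_def)
qed

section \<open>Sampling without replacement\<close>

text \<open>Removing \<open>D\<close> is a bijection onto the subsets of \<open>A - D\<close> of
  size \<open>k - card D\<close>. With \<open>D\<close> a singleton or a pair this counts the
  samples containing one or two given indices, as first and second moments require.\<close>

lemma card_subsets_superset: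
  assumes "finite A" "D \<subseteq> A" "card D \<le> k"
  shows "card {S. S \<subseteq> A \<and> card S = k \<and> D \<subseteq> S} = (card A - card D) choose (k - card D)"
proof -
  have fD: "finite D" using assms finite_subset by blast
  have "{S. S \<subseteq> A \<and> card S = k \<and> D \<subseteq> S} = (\<lambda>S. S \<union> D) ` {S. S \<subseteq> A - D \<and> card S = k - card D}"
    (is "?L = ?R")
  proof
    show "?L \<subseteq> ?R"
    proof
      fix S assume S: "S \<in> ?L"
      then have "S = (S - D) \<union> D" "S - D \<subseteq> A - D" "card (S - D) = k - card D"
        using fD by (auto simp: card_Diff_subset)
      then show "S \<in> ?R" by blast
    qed
    show "?R \<subseteq> ?L"
    proof
      fix S assume "S \<in> ?R"
      then obtain S' where S': "S = S' \<union> D" "S' \<subseteq> A - D" "card S' = k - card D" by blast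
      then have "finite S'" "S' \<inter> D = {}"
        using assms(1) finite_subset by blast+
      then have "card S = k"
        using S' fD assms(3) by (simp add: card_Un_disjoint)
      then show "S \<in> ?L" using S' assms(2) by auto
    qed
  qed
  moreover have "inj_on (\<lambda>S. S \<union> D) {S. S \<subseteq> A - D \<and> card S = k - card D}"
    by (rule inj_onI) blast
  ultimately have "card ?L = card {S. S \<subseteq> A - D \<and> card S = k - card D}"
    by (simp add: card_image)
  also have "\<dots> = card (A - D) choose (k - card D)"
    using assms(1) by (simp add: n_subsets)
  finally show ?thesis
    using assms fD by (simp add: card_Diff_subset)
qed

section \<open>First and second moments of a sample mean\<close>

definition set_mean :: "(nat \<Rightarrow> 'a::real_vector) \<Rightarrow> nat set \<Rightarrow> 'a" where
  "set_mean v S = (1 / real (card S)) *\<^sub>R (\<Sum>i\<in>S. v i)"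

abbreviation expect :: "'b pmf \<Rightarrow> ('b \<Rightarrow> real) \<Rightarrow> real" where
  "expect \<equiv> measure_pmf.expectation"

lemma
  assumes "b \<le> n"
  shows finite_subsets_of_card: "finite {S. S \<subseteq> {1..n::nat} \<and> card S = b}"
    and set_pmf_uniform_subset: "set_pmf (uniform_subset n b) = {S. S \<subseteq> {1..n} \<and> card S = b}"
    and finite_set_pmf_uniform_subset: "finite (set_pmf (uniform_subset n b))"
    and integrable_uniform_subset: "integrable (uniform_subset n b) (\<phi> :: nat set \<Rightarrow> real)"
    and expect_uniform_subset: "expect (uniform_subset n b) \<phi>
      = (\<Sum>S | S \<subseteq> {1..n} \<and> card S = b. \<phi> S) / real (n choose b)"
proof -
  show fin: "finite {S. S \<subseteq> {1..n} \<and> card S = b}"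
    by (rule finite_subset[of _ "Pow {1..n}"]) auto
  have "{1..b} \<in> {S. S \<subseteq> {1..n} \<and> card S = b}"
    using assms by auto
  then have ne: "{S. S \<subseteq> {1..n} \<and> card S = b} \<noteq> {}"
    by blast
  show set: "set_pmf (uniform_subset n b) = {S. S \<subseteq> {1..n} \<and> card S = b}"
    unfolding uniform_subset_def using fin ne by (rule set_pmf_of_set[rotated])
  then show "finite (set_pmf (uniform_subset n b))"
    using fin by simp
  then show "integrable (uniform_subset n b) \<phi>"
    by (rule integrable_measure_pmf_finite)
  have "card {S. S \<subseteq> {1..n} \<and> card S = b} = n choose b"
    using n_subsets[of "{1..n}" b] by simp
  then show "expect (uniform_subset n b) \<phi>
      = (\<Sum>S | S \<subseteq> {1..n} \<and> card S = b. \<phi> S) / real (n choose b)"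
    unfolding uniform_subset_def using integral_pmf_of_set[OF ne fin] by simp
qed

lemma binomial_ratio:
  assumes "1 \<le> b" "b \<le> n"
  shows "real ((n - 1) choose (b - 1)) / real (n choose b) = real b / real n"
proof -
  have "b * (n choose b) = n * ((n - 1) choose (b - 1))"
    using assms times_binomial_minus1_eq[of b n] by simp
  then have "real b * real (n choose b) = real n * real ((n - 1) choose (b - 1))"
    by (metis of_nat_mult)
  moreover have "real (n choose b) > 0" "real n > 0"
    using assms by auto
  ultimately show ?thesis
    by (simp add: field_simps)
qed

lemma sum_if_const:
  fixes c :: real
  assumes "finite A"
  shows "(\<Sum>x\<in>A. if P x then c else 0) = real (card {x \<in> A. P x}) * c"
  by (simp flip: sum.inter_filter[OF assms])

text \<open>After exchanging the sums over samples and indices, each index occurs in the fraction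
  \<open>b / n\<close> of the samples. Unbiasedness is tested against a vector \<open>w\<close>
  because \<open>expect\<close> is real-valued.\<close>

lemma expect_set_mean:
  fixes v :: "nat \<Rightarrow> 'a::real_inner"
  assumes "1 \<le> b" "b \<le> n"
  shows "expect (uniform_subset n b) (\<lambda>S. set_mean v S \<bullet> w) = set_mean v {1..n} \<bullet> w"
proof -
  let ?U = "{S. S \<subseteq> {1..n} \<and> card S = b}"
  have fin: "finite ?U"
    using assms finite_subsets_of_card by blast
  have "(\<Sum>S\<in>?U. set_mean v S \<bullet> w) = (\<Sum>S\<in>?U. \<Sum>i=1..n. if i \<in> S then (v i \<bullet> w) / b else 0)"
  proof (rule sum.cong[OF refl])
    fix S assume "S \<in> ?U"
    then have "{1..n} \<inter> S = S" "card S = b" by auto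
    then have "(\<Sum>i=1..n. if i \<in> S then (v i \<bullet> w) / b else 0) = (\<Sum>i\<in>S. (v i \<bullet> w) / b)"
      by (subst sum.inter_restrict[symmetric]) (simp_all only: finite_atLeastAtMost)
    also have "\<dots> = set_mean v S \<bullet> w"
      using \<open>card S = b\<close> by (simp add: set_mean_def inner_sum_left sum_divide_distrib)
    finally show "set_mean v S \<bullet> w = (\<Sum>i=1..n. if i \<in> S then (v i \<bullet> w) / b else 0)" ..
  qed
  also have "\<dots> = (\<Sum>i=1..n. \<Sum>S\<in>?U. if i \<in> S then (v i \<bullet> w) / b else 0)"
    by (rule sum.swap)
  also have "\<dots> = (\<Sum>i=1..n. real ((n - 1) choose (b - 1)) * ((v i \<bullet> w) / b))"
  proof (rule sum.cong[OF refl])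
    fix i assume i: "i \<in> {1..n}"
    have "(\<Sum>S\<in>?U. if i \<in> S then (v i \<bullet> w) / b else 0) = real (card {S\<in>?U. i \<in> S}) * ((v i \<bullet> w) / b)"
      by (rule sum_if_const[OF fin])
    also have "card {S\<in>?U. i \<in> S} = (n - 1) choose (b - 1)"
      using card_subsets_superset[of "{1..n}" "{i}" b] i assms by (simp add: conj_assoc)
    finally show "(\<Sum>S\<in>?U. if i \<in> S then (v i \<bullet> w) / b else 0)
      = real ((n - 1) choose (b - 1)) * ((v i \<bullet> w) / b)" .
  qed
  also have "\<dots> = real ((n - 1) choose (b - 1)) / b * (\<Sum>i=1..n. v i \<bullet> w)"
    by (simp add: sum_distrib_left)
  finally have "expect (uniform_subset n b) (\<lambda>S. set_mean v S \<bullet> w)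
      = (real ((n - 1) choose (b - 1)) / real (n choose b)) / b * (\<Sum>i=1..n. v i \<bullet> w)"
    using assms by (simp add: expect_uniform_subset)
  then show ?thesis
    unfolding binomial_ratio[OF assms] using assms by (simp add: set_mean_def inner_sum_left)
qed

text \<open>For centred vectors the cross terms of the square all have the same weight
  \<open>(n - 2) choose (b - 2)\<close>, so they add up to minus that multiple of the diagonal.\<close>

lemma expect_set_mean_centred_le:
  fixes u :: "nat \<Rightarrow> 'a::real_inner"
  assumes b: "1 \<le> b" "b \<le> n" and centred: "(\<Sum>i=1..n. u i) = 0"
  shows "expect (uniform_subset n b) (\<lambda>S. (norm (set_mean u S))\<^sup>2)
         \<le> (\<Sum>i=1..n. (norm (u i))\<^sup>2) / real n / real b"
proof -
  let ?U = "{S. S \<subseteq> {1..n} \<and> card S = b}"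
  define C1 where "C1 = real ((n - 1) choose (b - 1))"
  have fin: "finite ?U"
    using b finite_subsets_of_card by blast
  have c1: "real (card {S\<in>?U. i \<in> S \<and> i \<in> S}) = C1" if "i \<in> {1..n}" for i
    using card_subsets_superset[of "{1..n}" "{i}" b] that b by (simp add: conj_assoc C1_def)
  \<comment> \<open>For \<open>b = 1\<close> truncated subtraction would turn the binomial into
    \<open>(n - 2) choose 0 = 1\<close>, while no sample contains two indices.\<close>
  define c2 where "c2 = (if b \<ge> 2 then real ((n - 2) choose (b - 2)) else 0)"
  have c2: "real (card {S\<in>?U. i \<in> S \<and> j \<in> S}) = c2" if "i \<in> {1..n}" "j \<in> {1..n}" "i \<noteq> j" for i j
  proof (cases "b \<ge> 2")
    case True
    then show ?thesis
      using card_subsets_superset[of "{1..n}" "{i, j}" b] that b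
      by (simp add: conj_assoc c2_def numeral_2_eq_2)
  next
    case False
    have "\<not> (i \<in> S \<and> j \<in> S)" if "S \<in> ?U" for S
    proof
      assume "i \<in> S \<and> j \<in> S"
      moreover have "finite S" using that finite_subset by blast
      ultimately have "card {i, j} \<le> card S"
        by (intro card_mono) auto
      then show False using that False \<open>i \<noteq> j\<close> by simp
    qed
    then have "{S\<in>?U. i \<in> S \<and> j \<in> S} = {}" by blast
    then show ?thesis using False by (simp only: c2_def) simp
  qed
  have "(norm (set_mean u S))\<^sup>2 * (real b)\<^sup>2
      = (\<Sum>i=1..n. \<Sum>j=1..n. if i \<in> S \<and> j \<in> S then u i \<bullet> u j else 0)" if "S \<in> ?U" for S
  proof -
    have S: "{1..n} \<inter> S = S" "card S = b" using that by auto
    have "(norm (set_mean u S))\<^sup>2 * (real b)\<^sup>2 = (norm (\<Sum>i\<in>S. u i))\<^sup>2"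
      using S b by (simp add: set_mean_def power_mult_distrib power_divide)
    also have "(\<Sum>i\<in>S. u i) = (\<Sum>i=1..n. if i \<in> S then u i else 0)"
      by (subst sum.inter_restrict[symmetric]) (simp_all only: finite_atLeastAtMost S)
    also have "(norm \<dots>)\<^sup>2 = (\<Sum>i=1..n. \<Sum>j=1..n. (if i \<in> S then u i else 0) \<bullet> (if j \<in> S then u j else 0))"
      by (simp add: power2_norm_eq_inner inner_sum_left inner_sum_right) (rule sum.swap)
    also have "\<dots> = (\<Sum>i=1..n. \<Sum>j=1..n. if i \<in> S \<and> j \<in> S then u i \<bullet> u j else 0)"
      by (intro sum.cong) auto
    finally show ?thesis .
  qed
  then have "(\<Sum>S\<in>?U. (norm (set_mean u S))\<^sup>2 * (real b)\<^sup>2)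
      = (\<Sum>S\<in>?U. \<Sum>i=1..n. \<Sum>j=1..n. if i \<in> S \<and> j \<in> S then u i \<bullet> u j else 0)"
    by (intro sum.cong) auto
  also have "\<dots> = (\<Sum>i=1..n. \<Sum>S\<in>?U. \<Sum>j=1..n. if i \<in> S \<and> j \<in> S then u i \<bullet> u j else 0)"
    by (rule sum.swap)
  also have "\<dots> = (\<Sum>i=1..n. \<Sum>j=1..n. \<Sum>S\<in>?U. if i \<in> S \<and> j \<in> S then u i \<bullet> u j else 0)"
    by (intro sum.cong refl sum.swap)
  also have "\<dots> = (\<Sum>i=1..n. \<Sum>j=1..n. real (card {S\<in>?U. i \<in> S \<and> j \<in> S}) * (u i \<bullet> u j))"
    by (simp only: sum_if_const[OF fin])
  also have "\<dots> = (\<Sum>i=1..n. \<Sum>j=1..n. c2 * (u i \<bullet> u j) + (if j = i then (C1 - c2) * (u i \<bullet> u i) else 0))"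
  proof (intro sum.cong refl)
    fix i j assume "i \<in> {1..n}" "j \<in> {1..n}"
    then show "real (card {S\<in>?U. i \<in> S \<and> j \<in> S}) * (u i \<bullet> u j)
        = c2 * (u i \<bullet> u j) + (if j = i then (C1 - c2) * (u i \<bullet> u i) else 0)"
      using c1[of i] c2[of i j] by (cases "i = j") (auto simp: algebra_simps)
  qed
  also have "\<dots> = c2 * ((\<Sum>i=1..n. u i) \<bullet> (\<Sum>i=1..n. u i)) + (C1 - c2) * (\<Sum>i=1..n. u i \<bullet> u i)"
    by (simp add: sum.distrib sum_distrib_left inner_sum_left inner_sum_right sum.delta)
      (rule sum.swap)
  \<comment> \<open>Dropping \<open>c2\<close> on the diagonal gives up the finite-population factor
    \<open>(n - b) / (n - 1)\<close>. The full sample \<open>b = n\<close>, whose variance is zero,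
    is therefore treated apart in \<open>batch_variance_le\<close>.\<close>
  also have "\<dots> \<le> C1 * (\<Sum>i=1..n. (norm (u i))\<^sup>2)"
  proof -
    have "0 \<le> c2 * (\<Sum>i=1..n. u i \<bullet> u i)"
      by (simp add: c2_def sum_nonneg)
    then show ?thesis
      by (simp only: centred power2_norm_eq_inner inner_zero_left left_diff_distrib)
  qed
  finally have le: "(\<Sum>S\<in>?U. (norm (set_mean u S))\<^sup>2) * (real b)\<^sup>2 \<le> C1 * (\<Sum>i=1..n. (norm (u i))\<^sup>2)"
    by (simp add: sum_distrib_right)
  have "(\<Sum>S\<in>?U. (norm (set_mean u S))\<^sup>2) \<le> C1 * (\<Sum>i=1..n. (norm (u i))\<^sup>2) / (real b)\<^sup>2"
    using b le by (simp add: pos_le_divide_eq)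
  then have "(\<Sum>S\<in>?U. (norm (set_mean u S))\<^sup>2) / real (n choose b)
      \<le> C1 * (\<Sum>i=1..n. (norm (u i))\<^sup>2) / (real b)\<^sup>2 / real (n choose b)"
    by (intro divide_right_mono) auto
  also have "\<dots> = (C1 / real (n choose b)) * (\<Sum>i=1..n. (norm (u i))\<^sup>2) / (real b)\<^sup>2"
    by simp
  also have "\<dots> = (\<Sum>i=1..n. (norm (u i))\<^sup>2) / real n / real b"
    using b by (simp only: C1_def binomial_ratio) (simp add: power2_eq_square)
  finally show ?thesis
    using b by (simp add: expect_uniform_subset)
qed

lemma sum_minus_set_mean:
  fixes v :: "nat \<Rightarrow> 'a::real_vector"
  assumes "finite S" "S \<noteq> {}"
  shows "(\<Sum>i\<in>S. v i - set_mean v S) = 0"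
  using assms by (simp add: sum_subtractf set_mean_def sum_constant_scaleR)

text \<open>Pythagoras: the residuals add up to zero, so their cross terms with the mean cancel. An
  identity in spite of its name; dropping one or the other term on the left gives Jensen's
  inequality for the mean and the bound of a variance by a second moment.\<close>

lemma sum_norm_minus_set_mean_le:
  fixes v :: "nat \<Rightarrow> 'a::real_inner"
  assumes S: "finite S" "S \<noteq> {}"
  shows "(\<Sum>i\<in>S. (norm (v i - set_mean v S))\<^sup>2) + real (card S) * (norm (set_mean v S))\<^sup>2
         = (\<Sum>i\<in>S. (norm (v i))\<^sup>2)"
proof -
  let ?c = "set_mean v S"
  have "(norm (v i))\<^sup>2 = (norm (v i - ?c))\<^sup>2 + 2 * ((v i - ?c) \<bullet> ?c) + (norm ?c)\<^sup>2" for i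
    by (simp add: power2_norm_eq_inner inner_diff_left inner_diff_right inner_commute)
  then have "(\<Sum>i\<in>S. (norm (v i))\<^sup>2)
      = (\<Sum>i\<in>S. (norm (v i - ?c))\<^sup>2) + 2 * ((\<Sum>i\<in>S. v i - ?c) \<bullet> ?c) + real (card S) * (norm ?c)\<^sup>2"
    by (simp only: sum.distrib inner_sum_left sum_distrib_left) simp
  then show ?thesis
    by (simp add: sum_minus_set_mean[OF S, of v])
qed

lemma norm_set_mean_le:
  fixes v :: "nat \<Rightarrow> 'a::real_inner"
  assumes "finite S" "S \<noteq> {}"
  shows "(norm (set_mean v S))\<^sup>2 \<le> (\<Sum>i\<in>S. (norm (v i))\<^sup>2) / real (card S)"
proof -
  have "real (card S) > 0" using assms by (simp add: card_gt_0_iff)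
  moreover have "0 \<le> (\<Sum>i\<in>S. (norm (v i - set_mean v S))\<^sup>2)" by (simp add: sum_nonneg)
  ultimately show ?thesis
    using sum_norm_minus_set_mean_le[OF assms, of v] by (simp add: pos_le_divide_eq mult.commute)
qed

lemma expect_set_mean_variance_le:
  fixes v :: "nat \<Rightarrow> 'a::real_inner"
  assumes b: "1 \<le> b" "b \<le> n"
  shows "expect (uniform_subset n b) (\<lambda>S. (norm (set_mean v S - set_mean v {1..n}))\<^sup>2)
         \<le> (\<Sum>i=1..n. (norm (v i))\<^sup>2) / real n / real b"
proof -
  let ?c = "set_mean v {1..n}"
  have ne: "finite {1..n}" "{1..n} \<noteq> {}" using b by auto
  have "expect (uniform_subset n b) (\<lambda>S. (norm (set_mean v S - ?c))\<^sup>2)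
      = expect (uniform_subset n b) (\<lambda>S. (norm (set_mean (\<lambda>i. v i - ?c) S))\<^sup>2)"
  proof (intro integral_cong_AE)
    show "AE S in uniform_subset n b. (norm (set_mean v S - ?c))\<^sup>2 = (norm (set_mean (\<lambda>i. v i - ?c) S))\<^sup>2"
    proof (rule AE_pmfI)
      fix S assume "S \<in> set_pmf (uniform_subset n b)"
      then have "card S = b" using b by (simp add: set_pmf_uniform_subset)
      then have "set_mean (\<lambda>i. v i - ?c) S = set_mean v S - ?c"
        using b unfolding set_mean_def[of _ S]
        by (simp add: sum_subtractf sum_constant_scaleR scaleR_diff_right)
      then show "(norm (set_mean v S - ?c))\<^sup>2 = (norm (set_mean (\<lambda>i. v i - ?c) S))\<^sup>2" by simp
    qed
  qed auto
  also have "\<dots> \<le> (\<Sum>i=1..n. (norm (v i - ?c))\<^sup>2) / real n / real b"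
    by (rule expect_set_mean_centred_le[OF b sum_minus_set_mean[OF ne]])
  also have "\<dots> \<le> (\<Sum>i=1..n. (norm (v i))\<^sup>2) / real n / real b"
  proof (intro divide_right_mono)
    have "0 \<le> real (card {1..n}) * (norm ?c)\<^sup>2" by simp
    then show "(\<Sum>i=1..n. (norm (v i - ?c))\<^sup>2) \<le> (\<Sum>i=1..n. (norm (v i))\<^sup>2)"
      using sum_norm_minus_set_mean_le[OF ne, of v] by linarith
  qed auto
  finally show ?thesis .
qed

text \<open>Bias and variance of the inner search direction: there \<open>v\<close> are the gradient
  differences between the current point and the start of the epoch, and \<open>c\<close> is the
  batch gradient.\<close>

lemma expect_shifted_set_mean:
  fixes v :: "nat \<Rightarrow> 'a::real_inner"
  assumes b: "1 \<le> b" "b \<le> n"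
  shows "expect (uniform_subset n b) (\<lambda>S. (norm (set_mean v S + c))\<^sup>2)
         \<le> (norm (set_mean v {1..n} + c))\<^sup>2 + (\<Sum>i=1..n. (norm (v i))\<^sup>2) / real n / real b"
proof -
  let ?m = "set_mean v {1..n}" and ?U = "uniform_subset n b"
  note [simp] = integrable_uniform_subset[OF b(2)]
  \<comment> \<open>Arranged so that the random part of the cross term is linear in
    \<open>set_mean v S\<close> and can be evaluated by unbiasedness.\<close>
  have eq: "(norm (set_mean v S + c))\<^sup>2
      = (norm (set_mean v S - ?m))\<^sup>2 + 2 * (set_mean v S \<bullet> (?m + c)) + ((norm (?m + c))\<^sup>2 - 2 * (?m \<bullet> (?m + c)))" for S
    by (simp add: power2_norm_eq_inner algebra_simps inner_commute)
  have "expect ?U (\<lambda>S. (norm (set_mean v S + c))\<^sup>2)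
      = expect ?U (\<lambda>S. (norm (set_mean v S - ?m))\<^sup>2 + 2 * (set_mean v S \<bullet> (?m + c))
          + ((norm (?m + c))\<^sup>2 - 2 * (?m \<bullet> (?m + c))))"
    by (rule Bochner_Integration.integral_cong[OF refl eq])
  also have "\<dots> = expect ?U (\<lambda>S. (norm (set_mean v S - ?m))\<^sup>2) + 2 * expect ?U (\<lambda>S. set_mean v S \<bullet> (?m + c))
        + ((norm (?m + c))\<^sup>2 - 2 * (?m \<bullet> (?m + c)))"
    by simp
  finally show ?thesis
    using expect_set_mean_variance_le[OF b, of v] by (simp add: expect_set_mean[OF b])
qed

section \<open>One inner step\<close>

lemma batch_grad_eq_set_mean: "batch_grad f S x = set_mean (\<lambda>i. grad (f i) x) S"
  by (simp add: batch_grad_def set_mean_def)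

lemma power2_norm_add_le:
  fixes u v :: "'a::real_inner"
  shows "(norm (u + v))\<^sup>2 \<le> 2 * (norm u)\<^sup>2 + 2 * (norm v)\<^sup>2"
proof -
  have "0 \<le> (norm (u - v))\<^sup>2" by simp
  then show ?thesis
    by (simp add: power2_norm_eq_inner inner_add_left inner_add_right inner_diff_left inner_diff_right
        inner_commute)
qed

lemma inner_ge_young:
  fixes u v :: "'a::real_inner"
  assumes "0 < c"
  shows "- (2 * (u \<bullet> v)) \<le> c * (norm v)\<^sup>2 + (norm u)\<^sup>2 / c"
proof -
  have "0 \<le> (norm (u + c *\<^sub>R v))\<^sup>2 / c"
    using assms by simp
  also have "\<dots> = ((norm u)\<^sup>2 + 2 * c * (u \<bullet> v) + c\<^sup>2 * (norm v)\<^sup>2) / c"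
    unfolding power2_norm_eq_inner
    by (simp add: inner_add_left inner_add_right inner_commute[of v u] power2_eq_square algebra_simps)
  also have "\<dots> = (norm u)\<^sup>2 / c + 2 * (u \<bullet> v) + c * (norm v)\<^sup>2"
    using assms by (simp add: add_divide_distrib power2_eq_square)
  finally show ?thesis by simp
qed

lemma power2_norm_diff_scaleR:
  fixes a v :: "'a::real_inner"
  shows "(norm (a - t *\<^sub>R v))\<^sup>2 = (norm a)\<^sup>2 - 2 * t * (v \<bullet> a) + t\<^sup>2 * (norm v)\<^sup>2"
  unfolding power2_norm_eq_inner
  by (simp add: inner_diff_left inner_diff_right inner_commute[of a v] power2_eq_square algebra_simps)

section \<open>Consequences of convexity, smoothness and minimality\<close>

locale smooth_convex_sum =
  fixes f :: "nat \<Rightarrow> 'a::euclidean_space \<Rightarrow> real" and n :: nat and L :: real and xs :: 'a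
  assumes L_pos: "0 < L" and n_pos: "0 < n"
    and A1: "assumption_A1 f n L"
    and minimal: "\<And>x. objective f n xs \<le> objective f n x"
begin

abbreviation "F \<equiv> objective f n"

definition full_grad :: "'a \<Rightarrow> 'a" where
  "full_grad = batch_grad f {1..n}"

text \<open>The currency of the step analysis: the surplus of co-coercivity and the mini-batch
  variance are both bounded through this quantity, so one can pay for the other.\<close>

definition grad_dist :: "'a \<Rightarrow> 'a \<Rightarrow> real" where
  "grad_dist x y = (\<Sum>i=1..n. (norm (grad (f i) x - grad (f i) y))\<^sup>2) / real n"

lemma grad_dist_commute: "grad_dist x y = grad_dist y x"
  by (simp add: grad_dist_def norm_minus_commute)

lemma grad_dist_nonneg: "0 \<le> grad_dist x y"
  by (simp add: grad_dist_def sum_nonneg)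

lemma
  assumes "i \<in> {1..n}"
  shows GDERIV_component: "GDERIV (f i) x :> grad (f i) x"
    and component_above_gradient: "f i y + grad (f i) y \<bullet> (x - y) \<le> f i x"
    and component_smooth: "f i x \<le> f i y + grad (f i) y \<bullet> (x - y) + L / 2 * (norm (x - y))\<^sup>2"
proof -
  show deriv: "GDERIV (f i) x :> grad (f i) x" for x
    using A1 assms by (intro GDERIV_grad) (auto simp: assumption_A1_def)
  show "f i y + grad (f i) y \<bullet> (x - y) \<le> f i x"
    using A1 assms by (intro convex_on_above_gradient deriv) (auto simp: assumption_A1_def)
  show "f i x \<le> f i y + grad (f i) y \<bullet> (x - y) + L / 2 * (norm (x - y))\<^sup>2"
    using A1 assms unfolding assumption_A1_def by smt
qed

text \<open>Compare \<open>f i\<close> at the gradient step \<open>z\<close>, which minimises the quadratic upper bound at \<open>x\<close>,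
  with the tangent at \<open>y\<close>.\<close>

lemma component_above_gradient_strong:
  assumes i: "i \<in> {1..n}"
  shows "f i y + grad (f i) y \<bullet> (x - y) + (norm (grad (f i) x - grad (f i) y))\<^sup>2 / (2 * L) \<le> f i x"
proof -
  define g where "g = grad (f i) x - grad (f i) y"
  define z where "z = x - (1 / L) *\<^sub>R g"
  have "f i z \<le> f i x + grad (f i) x \<bullet> (z - x) + L / 2 * (norm (z - x))\<^sup>2"
    by (rule component_smooth[OF i])
  also have "L / 2 * (norm (z - x))\<^sup>2 = (norm g)\<^sup>2 / (2 * L)"
    using L_pos by (simp add: z_def power_divide power2_eq_square)
  finally have upper: "f i z \<le> f i x - (grad (f i) x \<bullet> g) / L + (norm g)\<^sup>2 / (2 * L)"
    by (simp add: z_def)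
  have "f i y + grad (f i) y \<bullet> (z - y) \<le> f i z"
    by (rule component_above_gradient[OF i])
  moreover have "grad (f i) y \<bullet> (z - y) = grad (f i) y \<bullet> (x - y) - (grad (f i) y \<bullet> g) / L"
    by (simp add: z_def inner_diff_right)
  moreover have "(grad (f i) x \<bullet> g) / L - (grad (f i) y \<bullet> g) / L = (norm g)\<^sup>2 / L"
    by (simp add: g_def power2_norm_eq_inner inner_diff_left flip: diff_divide_distrib)
  ultimately have "f i y + grad (f i) y \<bullet> (x - y) + (norm g)\<^sup>2 / L - (norm g)\<^sup>2 / (2 * L) \<le> f i x"
    using upper by linarith
  moreover have "(norm g)\<^sup>2 / L - (norm g)\<^sup>2 / (2 * L) = (norm g)\<^sup>2 / (2 * L)"
    using L_pos by (simp add: field_simps)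
  ultimately show ?thesis
    by (simp add: g_def)
qed

text \<open>Adding the strong tangent inequality to itself with \<open>x\<close> and
  \<open>y\<close> exchanged gives co-coercivity, and Cauchy-Schwarz finishes. The bound makes
  gradients continuous, hence measurable.\<close>

lemma grad_lipschitz:
  assumes "i \<in> {1..n}"
  shows "norm (grad (f i) x - grad (f i) y) \<le> L * norm (x - y)"
proof -
  let ?g = "grad (f i) x - grad (f i) y"
  have "(norm ?g)\<^sup>2 / (2 * L) + (norm ?g)\<^sup>2 / (2 * L) \<le> ?g \<bullet> (x - y)"
    using component_above_gradient_strong[OF assms, of y x] component_above_gradient_strong[OF assms, of x y]
    by (simp add: norm_minus_commute inner_diff_left inner_diff_right)
  also have "\<dots> \<le> norm ?g * norm (x - y)"
    by (rule norm_cauchy_schwarz)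
  finally have "norm ?g * norm ?g \<le> norm ?g * (L * norm (x - y))"
    using L_pos by (simp add: power2_eq_square field_simps)
  then show ?thesis
    using L_pos by (cases "norm ?g = 0") (auto simp: mult_le_cancel_left)
qed

lemma continuous_on_grad:
  assumes "i \<in> {1..n}"
  shows "continuous_on A (grad (f i))"
proof -
  have "L-lipschitz_on A (grad (f i))"
    using L_pos grad_lipschitz[OF assms] by (intro lipschitz_onI) (auto simp: dist_norm)
  then show ?thesis
    by (rule lipschitz_on_continuous_on)
qed

lemma continuous_on_batch_grad:
  assumes "S \<subseteq> {1..n}"
  shows "continuous_on A (batch_grad f S)"
  unfolding batch_grad_def
  using assms by (intro continuous_intros continuous_on_grad) auto

lemma continuous_on_objective: "continuous_on A F"
proof -
  have "continuous_on A (f i)" if "i \<in> {1..n}" for i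
  proof (rule has_derivative_continuous_on)
    show "(f i has_derivative (\<lambda>v. v \<bullet> grad (f i) x)) (at x within A)" for x
      using GDERIV_component[OF that] unfolding gderiv_def by (rule has_derivative_at_withinI)
  qed
  then show ?thesis
    unfolding objective_def using n_pos by (intro continuous_intros) auto
qed

lemma full_grad_inner: "full_grad y \<bullet> z = (\<Sum>i=1..n. grad (f i) y \<bullet> z) / real n"
  by (simp add: full_grad_def batch_grad_def inner_sum_left)

lemma objective_above_gradient: "F y + full_grad y \<bullet> (x - y) + grad_dist x y / (2 * L) \<le> F x"
proof -
  have "F y + full_grad y \<bullet> (x - y) + grad_dist x y / (2 * L)
      = (\<Sum>i=1..n. f i y + grad (f i) y \<bullet> (x - y) + (norm (grad (f i) x - grad (f i) y))\<^sup>2 / (2 * L)) / n"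
    by (simp add: objective_def full_grad_inner grad_dist_def sum.distrib add_divide_distrib
        sum_divide_distrib divide_divide_eq_left' mult.commute)
  also have "\<dots> \<le> (\<Sum>i=1..n. f i x) / n"
    by (intro divide_right_mono sum_mono component_above_gradient_strong) auto
  finally show ?thesis
    by (simp add: objective_def)
qed

lemma objective_smooth: "F x \<le> F y + full_grad y \<bullet> (x - y) + L / 2 * (norm (x - y))\<^sup>2"
proof -
  have "(\<Sum>i=1..n. f i x) / n \<le> (\<Sum>i=1..n. f i y + grad (f i) y \<bullet> (x - y) + L / 2 * (norm (x - y))\<^sup>2) / n"
    by (intro divide_right_mono sum_mono component_smooth) auto
  also have "\<dots> = F y + full_grad y \<bullet> (x - y) + L / 2 * (norm (x - y))\<^sup>2"
    using n_pos by (simp add: objective_def full_grad_inner sum.distrib add_divide_distrib)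
  finally show ?thesis
    by (simp add: objective_def)
qed

text \<open>A gradient step from \<open>xs\<close> with factor \<open>1 / L\<close> lowers
  \<open>F\<close> by at least \<open>(norm ?g)\<^sup>2 / (2 * L)\<close>, which minimality forbids
  unless this is zero.\<close>

lemma full_grad_minimizer: "full_grad xs = 0"
proof -
  let ?g = "full_grad xs"
  have "F xs \<le> F (xs - (1 / L) *\<^sub>R ?g)"
    by (rule minimal)
  also have "\<dots> \<le> F xs + ?g \<bullet> (- ((1 / L) *\<^sub>R ?g)) + L / 2 * (norm ((1 / L) *\<^sub>R ?g))\<^sup>2"
    using objective_smooth[of "xs - (1 / L) *\<^sub>R ?g" xs] by simp
  also have "\<dots> = F xs - (norm ?g)\<^sup>2 / (2 * L)"
    using L_pos by (simp add: power_divide dot_square_norm field_simps power2_eq_square)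
  finally have "(norm ?g)\<^sup>2 \<le> 0"
    using L_pos by (simp add: divide_le_0_iff)
  then show ?thesis by simp
qed

lemma objective_gap_le: "F x - F xs \<le> L / 2 * (norm (x - xs))\<^sup>2"
  using objective_smooth[of x xs] by (simp add: full_grad_minimizer)

lemma grad_dist_minimizer_le: "grad_dist x xs \<le> 2 * L * (F x - F xs)"
proof -
  have "grad_dist x xs / (2 * L) \<le> F x - F xs"
    using objective_above_gradient[of xs x] by (simp add: full_grad_minimizer)
  then show ?thesis
    using L_pos by (simp add: pos_divide_le_eq mult.commute)
qed

text \<open>As the full gradient vanishes at \<open>xs\<close>, the one at \<open>x\<close> is a
  mean of gradient differences, to which Jensen's inequality applies.\<close>

lemma norm_full_grad_le: "(norm (full_grad x))\<^sup>2 \<le> grad_dist x xs"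
proof -
  have "full_grad x = set_mean (\<lambda>i. grad (f i) x - grad (f i) xs) {1..n}"
    using full_grad_minimizer by (simp add: full_grad_def batch_grad_def set_mean_def sum_subtractf scaleR_diff_right)
  then show ?thesis
    using norm_set_mean_le[of "{1..n}" "\<lambda>i. grad (f i) x - grad (f i) xs"] n_pos
    by (simp add: grad_dist_def)
qed

text \<open>Splitting off the gradients at \<open>xs\<close> separates a part controlled by the gap,
  which the contraction absorbs, from a constant that survives as the noise of the final
  bound.\<close>

lemma grad_second_moment_le:
  "grad_second_moment f n x \<le> 4 * L * (F x - F xs) + 2 * grad_second_moment f n xs"
proof -
  have "(norm (grad (f i) x))\<^sup>2
      \<le> 2 * (norm (grad (f i) x - grad (f i) xs))\<^sup>2 + 2 * (norm (grad (f i) xs))\<^sup>2" for i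
    using power2_norm_add_le[of "grad (f i) x - grad (f i) xs" "grad (f i) xs"] by simp
  then have "grad_second_moment f n x
      \<le> (\<Sum>i=1..n. 2 * (norm (grad (f i) x - grad (f i) xs))\<^sup>2 + 2 * (norm (grad (f i) xs))\<^sup>2) / n"
    unfolding grad_second_moment_def by (intro divide_right_mono sum_mono) auto
  also have "\<dots> = 2 * grad_dist x xs + 2 * grad_second_moment f n xs"
    by (simp add: grad_dist_def grad_second_moment_def sum.distrib add_divide_distrib sum_distrib_left)
  finally show ?thesis
    using grad_dist_minimizer_le[of x] by simp
qed

lemma grad_second_moment_nonneg: "0 \<le> grad_second_moment f n x"
  by (simp add: grad_second_moment_def sum_nonneg)

text \<open>The last summand has mean zero over a uniformly random \<open>S\<close>, but not given \<open>S\<close>.\<close>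

definition epoch_error :: "real \<Rightarrow> real \<Rightarrow> real \<Rightarrow> 'a \<Rightarrow> nat set \<Rightarrow> real" where
  "epoch_error \<eta> G \<kappa> x S = 2 * \<eta> * G * (F x - F xs)
     + (\<eta>\<^sup>2 / (\<kappa> * G) + 2 * \<eta>\<^sup>2) * (norm (batch_grad f S x - full_grad x))\<^sup>2
     - 2 * \<eta> * (1 - G) * ((batch_grad f S x - full_grad x) \<bullet> (x - xs))"

text \<open>The batch \<open>S\<close> is held fixed and only the mini-batch is averaged. The two
  weights sum to one, so the combined distance changes like a single squared distance, its inner
  products merging into one with \<open>w\<close>.\<close>

lemma inner_step:
  fixes x y :: 'a and S :: "nat set"
  assumes b: "1 \<le> b" "b \<le> n" and pos: "0 < \<eta>" "0 < G" "G < 1" "0 < \<kappa>"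
    and step: "2 * \<eta> * L \<le> 1 - G" "\<eta> * L \<le> G * real b"
  defines "y' R \<equiv> y - \<eta> *\<^sub>R (batch_grad f R y - batch_grad f R x + batch_grad f S x)"
  shows "expect (uniform_subset n b) (\<lambda>R. (1 - G) * (norm (y' R - xs))\<^sup>2 + G * (norm (y' R - x))\<^sup>2)
           + 2 * \<eta> * (F y - F xs)
         \<le> (1 - G) * (norm (y - xs))\<^sup>2 + G * (1 + \<kappa>) * (norm (y - x))\<^sup>2 + epoch_error \<eta> G \<kappa> x S"
proof -
  let ?U = "uniform_subset n b"
  note int = integrable_uniform_subset[OF b(2)]
  define e where "e = batch_grad f S x - full_grad x"
  define c where "c = batch_grad f S x"
  define d where "d i = grad (f i) y - grad (f i) x" for i
  define w where "w = (1 - G) *\<^sub>R (y - xs) + G *\<^sub>R (y - x)"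
  have y': "y' R = y - \<eta> *\<^sub>R (set_mean d R + c)" for R
    by (simp add: y'_def c_def d_def batch_grad_def set_mean_def sum_subtractf scaleR_diff_right)
  \<comment> \<open>Up to the batch error \<open>e\<close> the search direction is unbiased: the
    mini-batch difference moves the full gradient from \<open>x\<close> to \<open>y\<close>.\<close>
  have mean_d: "set_mean d {1..n} + c = full_grad y + e"
    by (simp add: d_def c_def e_def full_grad_def batch_grad_def set_mean_def sum_subtractf scaleR_diff_right)
  have dist: "(norm (y' R - z))\<^sup>2 = (norm (y - z))\<^sup>2 - 2 * \<eta> * ((set_mean d R + c) \<bullet> (y - z))
      + \<eta>\<^sup>2 * (norm (set_mean d R + c))\<^sup>2" for R z
    using power2_norm_diff_scaleR[of "y - z" \<eta> "set_mean d R + c"]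
    unfolding y' by (simp add: algebra_simps)
  have "(1 - G) * (norm (y' R - xs))\<^sup>2 + G * (norm (y' R - x))\<^sup>2
      = ((1 - G) * (norm (y - xs))\<^sup>2 + G * (norm (y - x))\<^sup>2 - 2 * \<eta> * (c \<bullet> w))
        - 2 * \<eta> * (set_mean d R \<bullet> w) + \<eta>\<^sup>2 * (norm (set_mean d R + c))\<^sup>2" for R
    unfolding dist by (simp add: w_def algebra_simps)
  then have "expect ?U (\<lambda>R. (1 - G) * (norm (y' R - xs))\<^sup>2 + G * (norm (y' R - x))\<^sup>2)
      = ((1 - G) * (norm (y - xs))\<^sup>2 + G * (norm (y - x))\<^sup>2 - 2 * \<eta> * (c \<bullet> w))
        - 2 * \<eta> * expect ?U (\<lambda>R. set_mean d R \<bullet> w) + \<eta>\<^sup>2 * expect ?U (\<lambda>R. (norm (set_mean d R + c))\<^sup>2)"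
    by (simp add: int)
  also have "\<dots> = (1 - G) * (norm (y - xs))\<^sup>2 + G * (norm (y - x))\<^sup>2 - 2 * \<eta> * ((full_grad y + e) \<bullet> w)
      + \<eta>\<^sup>2 * expect ?U (\<lambda>R. (norm (set_mean d R + c))\<^sup>2)"
    unfolding expect_set_mean[OF b] mean_d[symmetric] by (simp add: algebra_simps)
  also have "expect ?U (\<lambda>R. (norm (set_mean d R + c))\<^sup>2)
      \<le> (norm (full_grad y + e))\<^sup>2 + grad_dist x y / real b"
    using expect_shifted_set_mean[OF b, of d c] unfolding mean_d
    by (simp add: d_def grad_dist_def norm_minus_commute)
  also have "(norm (full_grad y + e))\<^sup>2 \<le> 2 * grad_dist xs y + 2 * (norm e)\<^sup>2"
    using power2_norm_add_le[of "full_grad y" e] norm_full_grad_le[of y] by (simp add: grad_dist_commute)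
  finally have bound: "expect ?U (\<lambda>R. (1 - G) * (norm (y' R - xs))\<^sup>2 + G * (norm (y' R - x))\<^sup>2)
      \<le> (1 - G) * (norm (y - xs))\<^sup>2 + G * (norm (y - x))\<^sup>2 - 2 * \<eta> * ((full_grad y + e) \<bullet> w)
        + \<eta>\<^sup>2 * (2 * grad_dist xs y + 2 * (norm e)\<^sup>2 + grad_dist x y / real b)"
    by (simp add: mult_left_mono)
  \<comment> \<open>Tangents at \<open>y\<close>, evaluated at \<open>xs\<close> and at
    \<open>x\<close>, each with a surplus of \<open>grad_dist\<close>. The weighted gaps combine to
    the gap of \<open>y\<close> minus \<open>G\<close> times the gap of \<open>x\<close>.\<close>
  have "(1 - G) * (full_grad y \<bullet> (y - xs)) \<ge> (1 - G) * (F y - F xs + grad_dist xs y / (2 * L))"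
    using objective_above_gradient[of y xs] pos by (intro mult_left_mono) (auto simp: inner_diff_right)
  moreover have "G * (full_grad y \<bullet> (y - x)) \<ge> G * (F y - F x + grad_dist x y / (2 * L))"
    using objective_above_gradient[of y x] pos by (intro mult_left_mono) (auto simp: inner_diff_right)
  ultimately have "full_grad y \<bullet> w \<ge> (F y - F xs) - G * (F x - F xs)
      + (1 - G) * grad_dist xs y / (2 * L) + G * grad_dist x y / (2 * L)"
    by (simp add: w_def inner_add_right algebra_simps)
  then have "2 * \<eta> * (full_grad y \<bullet> w) \<ge> 2 * \<eta> * ((F y - F xs) - G * (F x - F xs)
      + (1 - G) * grad_dist xs y / (2 * L) + G * grad_dist x y / (2 * L))"
    using pos by (intro mult_left_mono) auto
  moreover have "2 * \<eta> * ((F y - F xs) - G * (F x - F xs)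
      + (1 - G) * grad_dist xs y / (2 * L) + G * grad_dist x y / (2 * L))
      = 2 * \<eta> * (F y - F xs) - 2 * \<eta> * G * (F x - F xs)
      + \<eta> * (1 - G) / L * grad_dist xs y + \<eta> * G / L * grad_dist x y"
    using L_pos by (simp add: field_simps)
  ultimately have grad_w: "2 * \<eta> * (full_grad y \<bullet> w) \<ge> 2 * \<eta> * (F y - F xs) - 2 * \<eta> * G * (F x - F xs)
      + \<eta> * (1 - G) / L * grad_dist xs y + \<eta> * G / L * grad_dist x y"
    by simp
  \<comment> \<open>The surplus at \<open>xs\<close> pays for the squared full gradient; this uses
    the step size bound by \<open>1 - G\<close>.\<close>
  have "\<eta>\<^sup>2 * 2 \<le> \<eta> * (1 - G) / L"
    using step(1) pos L_pos by (simp add: pos_le_divide_eq power2_eq_square mult.assoc mult_left_mono)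
  then have gd1: "\<eta>\<^sup>2 * 2 * grad_dist xs y \<le> \<eta> * (1 - G) / L * grad_dist xs y"
    by (intro mult_right_mono grad_dist_nonneg)
  \<comment> \<open>The surplus at \<open>x\<close> pays for the mini-batch variance; here the step
    size is limited by \<open>G * real b\<close>.\<close>
  have "\<eta>\<^sup>2 / real b \<le> \<eta> * G / L"
    using step(2) pos L_pos b by (simp add: field_simps power2_eq_square)
  then have gd2: "\<eta>\<^sup>2 / real b * grad_dist x y \<le> \<eta> * G / L * grad_dist x y"
    by (intro mult_right_mono grad_dist_nonneg)
  \<comment> \<open>This form of \<open>w\<close> isolates the direction \<open>x - xs\<close>,
    which is fixed during the epoch and against which the batch error averages to zero.\<close>
  have w: "w = (y - x) + (1 - G) *\<^sub>R (x - xs)"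
    by (simp add: w_def algebra_simps)
  \<comment> \<open>The Young parameter \<open>\<kappa> * G\<close> makes the new distance term
    exactly the excess of \<open>G * (1 + \<kappa>)\<close> over \<open>G\<close>.\<close>
  have "- (2 * ((\<eta> *\<^sub>R e) \<bullet> (y - x))) \<le> (\<kappa> * G) * (norm (y - x))\<^sup>2 + (norm (\<eta> *\<^sub>R e))\<^sup>2 / (\<kappa> * G)"
    using pos by (intro inner_ge_young) simp
  then have "- (2 * \<eta> * (e \<bullet> w)) \<le> (\<kappa> * G) * (norm (y - x))\<^sup>2 + \<eta>\<^sup>2 / (\<kappa> * G) * (norm e)\<^sup>2
      - 2 * \<eta> * (1 - G) * (e \<bullet> (x - xs))"
    unfolding w by (simp add: inner_add_right power_mult_distrib algebra_simps)
  with bound grad_w gd1 gd2 show ?thesis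
    unfolding epoch_error_def e_def[symmetric] by (simp add: inner_add_left algebra_simps)
qed

end

section \<open>The inner loop\<close>

text \<open>The bound follows from the limit of
  \<open>(\<Sum>k<K. (1 - \<gamma>) * \<gamma> ^ k * (a k + d k / \<kappa>)) + \<gamma> ^ K * (a K + c K) \<le> a 0 + (1 - \<gamma> ^ K) * C / \<kappa>\<close>
  for \<open>K\<close> to infinity; its boundary term may be dropped, being nonnegative.\<close>

lemma geometric_telescope:
  fixes a c d :: "nat \<Rightarrow> real" and \<kappa> C :: real
  assumes \<kappa>: "0 < \<kappa>" and nonneg: "\<And>k. 0 \<le> a k" "\<And>k. 0 \<le> c k" "\<And>k. 0 \<le> d k"
    and c0: "c 0 = 0"
    and step: "\<And>k. a (Suc k) + c (Suc k) + d k \<le> a k + (1 + \<kappa>) * c k + C"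
  shows "0 \<le> a 0 + C / \<kappa>"
    and "(\<integral>\<^sup>+k. ennreal (a k + d k / \<kappa>) \<partial>Geom (1 / (1 + \<kappa>))) \<le> ennreal (a 0 + C / \<kappa>)"
proof -
  define \<gamma> where "\<gamma> = 1 / (1 + \<kappa>)"
  define t where "t k = (1 - \<gamma>) * \<gamma> ^ k * (a k + d k / \<kappa>)" for k
  have \<gamma>: "0 < \<gamma>" "\<gamma> < 1" and \<gamma>\<kappa>: "\<gamma> * (1 + \<kappa>) = 1" "(1 - \<gamma>) / \<kappa> = \<gamma>"
  proof -
    have "\<gamma> + \<kappa> * \<gamma> = 1"
      using \<kappa> by (simp add: \<gamma>_def add_divide_distrib[symmetric])
    then have "1 - \<gamma> = \<kappa> * \<gamma>" by linarith
    then show "(1 - \<gamma>) / \<kappa> = \<gamma>" using \<kappa> by simp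
  qed (use \<kappa> in \<open>auto simp: \<gamma>_def\<close>)
  have t_nonneg: "0 \<le> t k" for k
    using \<gamma> \<kappa> nonneg by (simp add: t_def)
  have partial: "(\<Sum>k<K. t k) + \<gamma> ^ K * (a K + c K) \<le> a 0 + (1 - \<gamma> ^ K) * (C / \<kappa>)" for K
  proof (induction K)
    case 0
    then show ?case by (simp add: c0)
  next
    case (Suc K)
    have "\<gamma> ^ Suc K * (a (Suc K) + c (Suc K) + d K) \<le> \<gamma> ^ Suc K * (a K + (1 + \<kappa>) * c K + C)"
      using step[of K] \<gamma> by (intro mult_left_mono) auto
    \<comment> \<open>The factor \<open>1 + \<kappa>\<close> in front of \<open>c K\<close> is
      cancelled by one power of \<open>\<gamma>\<close>, so the \<open>c\<close> terms
      telescope.\<close>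
    also have "\<dots> = \<gamma> ^ Suc K * a K + \<gamma> ^ K * ((\<gamma> * (1 + \<kappa>)) * c K) + \<gamma> ^ K * \<gamma> * C"
      by (simp add: algebra_simps)
    also have "\<gamma> ^ K * \<gamma> * C = \<gamma> ^ K * ((1 - \<gamma>) / \<kappa>) * C"
      by (simp only: \<gamma>\<kappa>)
    also have "\<gamma> * (1 + \<kappa>) = 1"
      by (rule \<gamma>\<kappa>)
    finally have *: "\<gamma> ^ Suc K * (a (Suc K) + c (Suc K)) + \<gamma> ^ K * \<gamma> * d K
        \<le> \<gamma> ^ Suc K * a K + \<gamma> ^ K * c K + \<gamma> ^ K * ((1 - \<gamma>) / \<kappa>) * C"
      by (simp add: algebra_simps)
    have "t K = (1 - \<gamma>) * \<gamma> ^ K * a K + \<gamma> ^ K * ((1 - \<gamma>) / \<kappa>) * d K"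
      by (simp add: t_def algebra_simps diff_divide_distrib)
    then have "t K = \<gamma> ^ K * a K - \<gamma> ^ Suc K * a K + \<gamma> ^ K * \<gamma> * d K"
      by (simp only: \<gamma>\<kappa>) (simp add: algebra_simps)
    moreover have "(1 - \<gamma> ^ Suc K) * (C / \<kappa>)
        = (1 - \<gamma> ^ K) * (C / \<kappa>) + \<gamma> ^ K * ((1 - \<gamma>) / \<kappa>) * C"
      by (simp add: algebra_simps diff_divide_distrib)
    moreover have "\<gamma> ^ K * (a K + c K) = \<gamma> ^ K * a K + \<gamma> ^ K * c K"
      by (simp add: algebra_simps)
    ultimately show ?case
      using Suc * by simp
  qed
  have bound: "(\<Sum>k<K. t k) \<le> a 0 + (1 - \<gamma> ^ K) * (C / \<kappa>)" for K
  proof -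
    have "0 \<le> \<gamma> ^ K * (a K + c K)"
      using \<gamma> nonneg by simp
    then show ?thesis
      using partial[of K] by linarith
  qed
  have lim: "(\<lambda>K. a 0 + (1 - \<gamma> ^ K) * (C / \<kappa>)) \<longlonglongrightarrow> a 0 + (1 - 0) * (C / \<kappa>)"
    using \<gamma> by (intro tendsto_intros LIMSEQ_power_zero) auto
  \<comment> \<open>\<open>C\<close> has no sign, while \<open>ennreal\<close> truncates at zero;
    knowing that the bound is nonnegative allows averaging it later as a real number.\<close>
  have "0 \<le> a 0 + (1 - \<gamma> ^ K) * (C / \<kappa>)" for K
    using order_trans[OF sum_nonneg bound] t_nonneg by blast
  then show "0 \<le> a 0 + C / \<kappa>"
    using LIMSEQ_le_const[OF lim, of 0] by auto
  \<comment> \<open>A bound independent of \<open>K\<close>, whatever the sign of \<open>C\<close>,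
    to obtain summability.\<close>
  have "(\<Sum>k<K. t k) \<le> a 0 + \<bar>C / \<kappa>\<bar>" for K
  proof -
    have "0 \<le> \<gamma> ^ K" "\<gamma> ^ K \<le> 1"
      using \<gamma> by (auto simp: power_le_one)
    then have "\<bar>(1 - \<gamma> ^ K) * (C / \<kappa>)\<bar> \<le> 1 * \<bar>C / \<kappa>\<bar>"
      unfolding abs_mult by (intro mult_right_mono) auto
    then show ?thesis
      using bound[of K] by linarith
  qed
  then have summable: "summable t"
    using t_nonneg by (intro summableI_nonneg_bounded) auto
  have "suminf t \<le> a 0 + C / \<kappa>"
    using LIMSEQ_le[OF summable_LIMSEQ[OF summable] lim] bound by auto
  moreover have "(\<integral>\<^sup>+k. ennreal (a k + d k / \<kappa>) \<partial>Geom \<gamma>) = ennreal (suminf t)"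
  proof -
    have "(\<integral>\<^sup>+k. ennreal (a k + d k / \<kappa>) \<partial>Geom \<gamma>)
        = (\<Sum>k. ennreal (pmf (Geom \<gamma>) k) * ennreal (a k + d k / \<kappa>))"
      by (simp add: nn_integral_measure_pmf nn_integral_count_space_nat)
    also have "\<dots> = (\<Sum>k. ennreal (t k))"
      using \<gamma> \<kappa> nonneg by (intro suminf_cong) (simp add: Geom_def t_def ennreal_mult mult.commute mult.left_commute)
    also have "\<dots> = ennreal (suminf t)"
      by (rule suminf_ennreal2[OF t_nonneg summable])
    finally show ?thesis .
  qed
  ultimately show "(\<integral>\<^sup>+k. ennreal (a k + d k / \<kappa>) \<partial>Geom (1 / (1 + \<kappa>))) \<le> ennreal (a 0 + C / \<kappa>)"
    by (simp add: \<gamma>_def ennreal_leI)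
qed

text \<open>Only the \<open>k\<close> mini-batches that are looked at are random, the others are
  \<open>{}\<close>. For \<open>b \<le> n\<close> the support is then finite, and integrability
  inside the loop is automatic.\<close>

definition mini_pmf :: "nat \<Rightarrow> nat \<Rightarrow> nat \<Rightarrow> (nat \<Rightarrow> nat set) pmf" where
  "mini_pmf n b k = Pi_pmf {..<k} {} (\<lambda>_. uniform_subset n b)"

lemma mini_pmf_Suc:
  "mini_pmf n b (Suc k)
   = bind_pmf (mini_pmf n b k) (\<lambda>R. map_pmf (\<lambda>Q. R(k := Q)) (uniform_subset n b))"
  unfolding mini_pmf_def lessThan_Suc
  by (subst Pi_pmf_insert', simp, simp) (subst bind_commute_pmf, simp add: map_pmf_def)

lemma finite_set_pmf_mini_pmf:
  assumes "b \<le> n"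
  shows "finite (set_pmf (mini_pmf n b k))"
proof (induction k)
  case 0
  then show ?case by (simp add: mini_pmf_def)
next
  case (Suc k)
  then show ?case
    using finite_set_pmf_uniform_subset[OF assms] by (simp add: mini_pmf_Suc)
qed

lemma scsg_inner_cong:
  assumes "\<And>i. i < k \<Longrightarrow> R i = R' i"
  shows "scsg_inner f \<eta> x S R k = scsg_inner f \<eta> x S R' k"
  using assms by (induction k) (auto simp: Let_def)

lemma expect_bind_finite:
  fixes h :: "'b \<Rightarrow> real"
  assumes "finite (set_pmf p)" "\<And>a. a \<in> set_pmf p \<Longrightarrow> finite (set_pmf (q a))"
  shows "expect (bind_pmf p q) h = expect p (\<lambda>a. expect (q a) h)"
  using assms by (subst pmf_expectation_bind[of "set_pmf p"])
    (auto simp: integral_measure_pmf[of "set_pmf p"])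

text \<open>Overwriting position \<open>k\<close> leaves the first \<open>k\<close> steps untouched,
  so the fresh mini-batch can be averaged with the current iterate held fixed.\<close>

lemma expect_inner_Suc:
  fixes \<phi> :: "'a::euclidean_space \<Rightarrow> real"
  assumes b: "b \<le> n"
  shows "expect (mini_pmf n b (Suc k)) (\<lambda>R. \<phi> (scsg_inner f \<eta> x S R (Suc k)))
    = expect (mini_pmf n b k) (\<lambda>R. let y = scsg_inner f \<eta> x S R k in expect (uniform_subset n b)
        (\<lambda>Q. \<phi> (y - \<eta> *\<^sub>R (batch_grad f Q y - batch_grad f Q x + batch_grad f S x))))"
proof -
  have "scsg_inner f \<eta> x S (R(k := Q)) k = scsg_inner f \<eta> x S R k" for R Q
    by (rule scsg_inner_cong) auto
  then show ?thesis
    using b by (simp add: mini_pmf_Suc expect_bind_finite finite_set_pmf_mini_pmf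
        finite_set_pmf_uniform_subset Let_def)
qed

context smooth_convex_sum
begin

definition lyapunov :: "real \<Rightarrow> 'a \<Rightarrow> real" where
  "lyapunov \<rho> y = F y - F xs + \<rho> * (norm (y - xs))\<^sup>2"

lemma lyapunov_nonneg: "0 \<le> \<rho> \<Longrightarrow> 0 \<le> lyapunov \<rho> y"
  using minimal[of y] by (simp add: lyapunov_def)

lemma inner_loop:
  fixes x :: 'a and S :: "nat set"
  assumes b: "1 \<le> b" "b \<le> n" and pos: "0 < \<eta>" "0 < G" "G < 1" "0 < \<kappa>"
    and step: "2 * \<eta> * L \<le> 1 - G" "\<eta> * L \<le> G * real b"
  defines "\<rho> \<equiv> (1 - G) * \<kappa> / (2 * \<eta>)"
  shows "0 \<le> \<rho> * (norm (x - xs))\<^sup>2 + epoch_error \<eta> G \<kappa> x S / (2 * \<eta>)"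
    and "(\<integral>\<^sup>+k. (\<integral>\<^sup>+R. ennreal (lyapunov \<rho> (scsg_inner f \<eta> x S R k)) \<partial>mini_pmf n b k)
            \<partial>Geom (1 / (1 + \<kappa>)))
         \<le> ennreal (\<rho> * (norm (x - xs))\<^sup>2 + epoch_error \<eta> G \<kappa> x S / (2 * \<eta>))"
proof -
  let ?M = "mini_pmf n b" and ?U = "uniform_subset n b"
  note int = integrable_measure_pmf_finite[OF finite_set_pmf_mini_pmf[OF b(2)]]
    integrable_uniform_subset[OF b(2)]
  define y where "y R k = scsg_inner f \<eta> x S R k" for R k
  \<comment> \<open>The scale that turns \<open>2 * \<eta>\<close> times the gap into
    \<open>\<kappa>\<close> times the gap: then \<open>d k / \<kappa>\<close> is the plain expected
    gap and \<open>a k\<close> carries the weight \<open>\<rho>\<close>.\<close>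
  define s where "s = \<kappa> / (2 * \<eta>)"
  define a where "a k = s * expect (?M k) (\<lambda>R. (1 - G) * (norm (y R k - xs))\<^sup>2)" for k
  define c where "c k = s * expect (?M k) (\<lambda>R. G * (norm (y R k - x))\<^sup>2)" for k
  define d where "d k = \<kappa> * expect (?M k) (\<lambda>R. F (y R k) - F xs)" for k
  define E where "E = epoch_error \<eta> G \<kappa> x S"
  have s: "0 < s" and \<rho>: "0 \<le> \<rho>" "\<rho> = s * (1 - G)" and s2: "s * (2 * \<eta>) = \<kappa>" "s / \<kappa> = 1 / (2 * \<eta>)"
    using pos by (auto simp: s_def \<rho>_def)
  have nonneg: "0 \<le> a k" "0 \<le> c k" "0 \<le> d k" for k
    using s pos minimal unfolding a_def c_def d_def
    by (auto intro!: mult_nonneg_nonneg integral_nonneg_AE)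
  \<comment> \<open>The loop starts at \<open>x\<close>, so the auxiliary distance \<open>c\<close>
    is initially zero.\<close>
  have zero: "c 0 = 0" "a 0 = \<rho> * (norm (x - xs))\<^sup>2"
    by (auto simp: c_def a_def y_def mini_pmf_def \<rho>)
  have "a (Suc k) + c (Suc k) + d k \<le> a k + (1 + \<kappa>) * c k + s * E" for k
  proof -
    define \<phi> where "\<phi> z = (1 - G) * (norm (z - xs))\<^sup>2 + G * (norm (z - x))\<^sup>2" for z
    have "expect (?M (Suc k)) (\<lambda>R. \<phi> (y R (Suc k)))
        = expect (?M k) (\<lambda>R. expect ?U (\<lambda>Q. \<phi> (y R k - \<eta> *\<^sub>R (batch_grad f Q (y R k) - batch_grad f Q x + batch_grad f S x))))"
      unfolding y_def by (subst expect_inner_Suc[OF b(2)]) (simp add: Let_def)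
    also have "\<dots> \<le> expect (?M k) (\<lambda>R. ((1 - G) * (norm (y R k - xs))\<^sup>2
        + (1 + \<kappa>) * (G * (norm (y R k - x))\<^sup>2) + E) - 2 * \<eta> * (F (y R k) - F xs))"
    proof (intro integral_mono_AE AE_pmfI int)
      fix R
      show "expect ?U (\<lambda>Q. \<phi> (y R k - \<eta> *\<^sub>R (batch_grad f Q (y R k) - batch_grad f Q x + batch_grad f S x)))
        \<le> ((1 - G) * (norm (y R k - xs))\<^sup>2
        + (1 + \<kappa>) * (G * (norm (y R k - x))\<^sup>2) + E) - 2 * \<eta> * (F (y R k) - F xs)"
        using inner_step[OF b pos step, of "y R k" x S]
        unfolding \<phi>_def E_def by (simp add: mult_ac)
    qed
    also have "\<dots> = expect (?M k) (\<lambda>R. (1 - G) * (norm (y R k - xs))\<^sup>2)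
        + (1 + \<kappa>) * expect (?M k) (\<lambda>R. G * (norm (y R k - x))\<^sup>2) + E
        - 2 * \<eta> * expect (?M k) (\<lambda>R. F (y R k) - F xs)"
      by (simp only: Bochner_Integration.integral_diff[OF int(1) int(1)]
          Bochner_Integration.integral_add[OF int(1) int(1)] integral_mult_right_zero) simp
    also have "expect (?M (Suc k)) (\<lambda>R. \<phi> (y R (Suc k)))
        = expect (?M (Suc k)) (\<lambda>R. (1 - G) * (norm (y R (Suc k) - xs))\<^sup>2)
          + expect (?M (Suc k)) (\<lambda>R. G * (norm (y R (Suc k) - x))\<^sup>2)"
      unfolding \<phi>_def by (rule Bochner_Integration.integral_add[OF int(1) int(1)])
    finally have "s * (expect (?M (Suc k)) (\<lambda>R. (1 - G) * (norm (y R (Suc k) - xs))\<^sup>2)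
          + expect (?M (Suc k)) (\<lambda>R. G * (norm (y R (Suc k) - x))\<^sup>2))
        \<le> s * (expect (?M k) (\<lambda>R. (1 - G) * (norm (y R k - xs))\<^sup>2)
        + (1 + \<kappa>) * expect (?M k) (\<lambda>R. G * (norm (y R k - x))\<^sup>2) + E
        - 2 * \<eta> * expect (?M k) (\<lambda>R. F (y R k) - F xs))"
      using s by (intro mult_left_mono) auto
    then have "a (Suc k) + c (Suc k) \<le> a k + (1 + \<kappa>) * c k + s * E
        - (s * (2 * \<eta>)) * expect (?M k) (\<lambda>R. F (y R k) - F xs)"
      unfolding a_def c_def by (simp add: algebra_simps)
    then show ?thesis
      unfolding s2 d_def by simp
  qed
  note telescope = geometric_telescope[OF pos(4) nonneg zero(1) this]
  have E: "s * E / \<kappa> = E / (2 * \<eta>)"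
    using pos by (simp add: s_def)
  show "0 \<le> \<rho> * (norm (x - xs))\<^sup>2 + epoch_error \<eta> G \<kappa> x S / (2 * \<eta>)"
    using telescope(1) unfolding zero E by (simp add: E_def)
  have "(\<integral>\<^sup>+R. ennreal (lyapunov \<rho> (y R k)) \<partial>?M k) = ennreal (a k + d k / \<kappa>)" for k
  proof -
    have "(\<integral>\<^sup>+R. ennreal (lyapunov \<rho> (y R k)) \<partial>?M k) = ennreal (expect (?M k) (\<lambda>R. lyapunov \<rho> (y R k)))"
      using lyapunov_nonneg \<rho> by (intro nn_integral_eq_integral int) auto
    also have "expect (?M k) (\<lambda>R. lyapunov \<rho> (y R k))
        = expect (?M k) (\<lambda>R. F (y R k) - F xs) + expect (?M k) (\<lambda>R. s * ((1 - G) * (norm (y R k - xs))\<^sup>2))"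
      unfolding lyapunov_def \<rho>(2) mult.assoc by (rule Bochner_Integration.integral_add[OF int(1) int(1)])
    also have "\<dots> = a k + d k / \<kappa>"
      using pos unfolding a_def d_def integral_mult_right_zero by simp
    finally show ?thesis .
  qed
  then show "(\<integral>\<^sup>+k. (\<integral>\<^sup>+R. ennreal (lyapunov \<rho> (scsg_inner f \<eta> x S R k)) \<partial>mini_pmf n b k)
            \<partial>Geom (1 / (1 + \<kappa>)))
         \<le> ennreal (\<rho> * (norm (x - xs))\<^sup>2 + epoch_error \<eta> G \<kappa> x S / (2 * \<eta>))"
    using telescope(2) unfolding zero E by (simp add: E_def y_def)
qed

end

section \<open>The law of an epoch\<close>

type_synonym epoch_draw = "nat set \<times> nat \<times> (nat \<Rightarrow> nat set)"

text \<open>A whole epoch as one discrete draw. Mini-batches are generated only up to the drawn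
  number of steps, since infinite sequences would in general have no discrete law.\<close>

definition epoch_pmf :: "nat \<Rightarrow> nat \<Rightarrow> nat \<Rightarrow> real \<Rightarrow> epoch_draw pmf" where
  "epoch_pmf n B b \<gamma> = pair_pmf (uniform_subset n B)
     (bind_pmf (Geom \<gamma>) (\<lambda>k. map_pmf (Pair k) (mini_pmf n b k)))"

definition epoch :: "(nat \<Rightarrow> 'a::euclidean_space \<Rightarrow> real) \<Rightarrow> real \<Rightarrow> 'a \<Rightarrow> epoch_draw \<Rightarrow> 'a" where
  "epoch f \<eta> x z = (case z of (S, k, R) \<Rightarrow> scsg_inner f \<eta> x S R k)"

lemma pmf_epoch_pmf:
  "pmf (epoch_pmf n B b \<gamma>) (S, k, R)
   = pmf (uniform_subset n B) S * (pmf (Geom \<gamma>) k * pmf (mini_pmf n b k) R)"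
proof -
  have "pmf (map_pmf (Pair k') (mini_pmf n b k')) (k, R) = indicator {k} k' * pmf (mini_pmf n b k) R" for k'
  proof (cases "k' = k")
    case True
    then show ?thesis by (simp add: pmf_map_inj' inj_on_def)
  next
    case False
    then have "(k, R) \<notin> Pair k' ` set_pmf (mini_pmf n b k')" by auto
    then show ?thesis
      using False by (simp add: pmf_map_outside)
  qed
  then have "pmf (bind_pmf (Geom \<gamma>) (\<lambda>k. map_pmf (Pair k) (mini_pmf n b k))) (k, R)
      = pmf (Geom \<gamma>) k * pmf (mini_pmf n b k) R"
    by (simp add: pmf_bind measure_pmf_single)
  then show ?thesis
    by (simp add: epoch_pmf_def pmf_pair)
qed

context smooth_convex_sum
begin

text \<open>A batch of size \<open>n\<close> is the whole index set, so its gradient is exact. This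
  is why the noise stops once the batches are full.\<close>

lemma batch_variance_le:
  assumes B: "1 \<le> B" "B \<le> n"
  shows "expect (uniform_subset n B) (\<lambda>S. (norm (batch_grad f S x - full_grad x))\<^sup>2)
    \<le> (if B < n then (4 * L * (F x - F xs) + 2 * grad_second_moment f n xs) / real B else 0)"
proof (cases "B < n")
  case True
  have "expect (uniform_subset n B) (\<lambda>S. (norm (batch_grad f S x - full_grad x))\<^sup>2)
      \<le> grad_second_moment f n x / real B"
    using expect_set_mean_variance_le[OF B, of "\<lambda>i. grad (f i) x"]
    by (simp add: batch_grad_eq_set_mean full_grad_def grad_second_moment_def)
  also have "\<dots> \<le> (4 * L * (F x - F xs) + 2 * grad_second_moment f n xs) / real B"
    by (intro divide_right_mono grad_second_moment_le) simp
  finally show ?thesis using True by simp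
next
  case False
  have "expect (uniform_subset n B) (\<lambda>S. (norm (batch_grad f S x - full_grad x))\<^sup>2)
      = expect (uniform_subset n B) (\<lambda>S. 0)"
  proof (intro integral_cong_AE AE_pmfI)
    fix S assume "S \<in> set_pmf (uniform_subset n B)"
    then have "S \<subseteq> {1..n}" "card S = card {1..n}"
      using B False by (auto simp: set_pmf_uniform_subset)
    then have "S = {1..n}"
      by (intro card_subset_eq) auto
    then show "(norm (batch_grad f S x - full_grad x))\<^sup>2 = 0"
      by (simp add: full_grad_def)
  qed auto
  then show ?thesis using False by simp
qed

text \<open>Unbiasedness of the batch gradient removes the inner product with \<open>x - xs\<close>,
  the one part of the epoch error without a sign.\<close>

lemma expect_epoch_error_le:
  assumes B: "1 \<le> B" "B \<le> n" and pos: "0 < \<eta>" "0 < G" "0 < \<kappa>"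
  shows "expect (uniform_subset n B) (epoch_error \<eta> G \<kappa> x)
    \<le> 2 * \<eta> * G * (F x - F xs) + (\<eta>\<^sup>2 / (\<kappa> * G) + 2 * \<eta>\<^sup>2) *
      (if B < n then (4 * L * (F x - F xs) + 2 * grad_second_moment f n xs) / real B else 0)"
proof -
  let ?U = "uniform_subset n B"
  note int = integrable_uniform_subset[OF B(2)]
  have "expect ?U (\<lambda>S. batch_grad f S x \<bullet> (x - xs)) = full_grad x \<bullet> (x - xs)"
    using expect_set_mean[OF B] by (simp add: batch_grad_eq_set_mean full_grad_def)
  then have "expect ?U (\<lambda>S. (batch_grad f S x - full_grad x) \<bullet> (x - xs)) = 0"
    unfolding inner_diff_left by (simp add: int)
  then have "expect ?U (epoch_error \<eta> G \<kappa> x) = 2 * \<eta> * G * (F x - F xs)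
      + (\<eta>\<^sup>2 / (\<kappa> * G) + 2 * \<eta>\<^sup>2) * expect ?U (\<lambda>S. (norm (batch_grad f S x - full_grad x))\<^sup>2)"
    unfolding epoch_error_def by (simp add: int)
  also have "\<dots> \<le> 2 * \<eta> * G * (F x - F xs) + (\<eta>\<^sup>2 / (\<kappa> * G) + 2 * \<eta>\<^sup>2) *
      (if B < n then (4 * L * (F x - F xs) + 2 * grad_second_moment f n xs) / real B else 0)"
    using pos by (intro add_left_mono mult_left_mono batch_variance_le[OF B]) auto
  finally show ?thesis .
qed

lemma epoch_bound:
  assumes b: "1 \<le> b" "b \<le> n" and B: "1 \<le> B" "B \<le> n"
    and pos: "0 < \<eta>" "0 < G" "G < 1" "0 < \<kappa>"
    and step: "2 * \<eta> * L \<le> 1 - G" "\<eta> * L \<le> G * real b"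
  defines "\<rho> \<equiv> (1 - G) * \<kappa> / (2 * \<eta>)"
  shows "(\<integral>\<^sup>+z. ennreal (lyapunov \<rho> (epoch f \<eta> x z)) \<partial>epoch_pmf n B b (1 / (1 + \<kappa>)))
    \<le> ennreal (\<rho> * (norm (x - xs))\<^sup>2 + G * (F x - F xs) + (\<eta> / (2 * \<kappa> * G) + \<eta>) *
        (if B < n then (4 * L * (F x - F xs) + 2 * grad_second_moment f n xs) / real B else 0))"
proof -
  let ?U = "uniform_subset n B"
  note int = integrable_uniform_subset[OF B(2)]
  note loop = inner_loop[OF b pos step, folded \<rho>_def]
  have "(\<integral>\<^sup>+z. ennreal (lyapunov \<rho> (epoch f \<eta> x z)) \<partial>epoch_pmf n B b (1 / (1 + \<kappa>)))
      = (\<integral>\<^sup>+S. (\<integral>\<^sup>+k. (\<integral>\<^sup>+R. ennreal (lyapunov \<rho> (scsg_inner f \<eta> x S R k)) \<partial>mini_pmf n b k)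
            \<partial>Geom (1 / (1 + \<kappa>))) \<partial>?U)"
    by (simp add: epoch_pmf_def epoch_def nn_integral_pair_pmf')
  also have "\<dots> \<le> (\<integral>\<^sup>+S. ennreal (\<rho> * (norm (x - xs))\<^sup>2 + epoch_error \<eta> G \<kappa> x S / (2 * \<eta>)) \<partial>?U)"
    by (intro nn_integral_mono loop(2))
  \<comment> \<open>Back to real expectations, since \<open>loop(1)\<close> makes the integrand
    nonnegative for every batch; only now can positive and negative parts of the error
    cancel.\<close>
  also have "\<dots> = ennreal (expect ?U (\<lambda>S. \<rho> * (norm (x - xs))\<^sup>2 + epoch_error \<eta> G \<kappa> x S / (2 * \<eta>)))"
    using loop(1) by (intro nn_integral_eq_integral int) auto
  also have "expect ?U (\<lambda>S. \<rho> * (norm (x - xs))\<^sup>2 + epoch_error \<eta> G \<kappa> x S / (2 * \<eta>))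
      = \<rho> * (norm (x - xs))\<^sup>2 + expect ?U (epoch_error \<eta> G \<kappa> x) / (2 * \<eta>)"
    by (simp add: int)
  also have "expect ?U (epoch_error \<eta> G \<kappa> x) / (2 * \<eta>) \<le> (2 * \<eta> * G * (F x - F xs) + (\<eta>\<^sup>2 / (\<kappa> * G) + 2 * \<eta>\<^sup>2) *
      (if B < n then (4 * L * (F x - F xs) + 2 * grad_second_moment f n xs) / real B else 0)) / (2 * \<eta>)"
    using pos by (intro divide_right_mono expect_epoch_error_le[OF B]) auto
  also have "\<dots> = G * (F x - F xs) + (\<eta> / (2 * \<kappa> * G) + \<eta>) *
      (if B < n then (4 * L * (F x - F xs) + 2 * grad_second_moment f n xs) / real B else 0)"
    (is "(_ + _ * ?\<sigma>) / _ = _")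
  proof -
    have "(\<eta>\<^sup>2 / (\<kappa> * G) + 2 * \<eta>\<^sup>2) / (2 * \<eta>) = \<eta> / (2 * \<kappa> * G) + \<eta>"
      using pos by (simp add: field_simps power2_eq_square)
    then have "(\<eta>\<^sup>2 / (\<kappa> * G) + 2 * \<eta>\<^sup>2) * ?\<sigma> / (2 * \<eta>) = (\<eta> / (2 * \<kappa> * G) + \<eta>) * ?\<sigma>"
      by (metis times_divide_eq_left)
    then show ?thesis
      using pos by (simp add: add_divide_distrib)
  qed
  finally show ?thesis
    by (simp add: ennreal_leI add.assoc)
qed

end

section \<open>Conditioning on the past\<close>

text \<open>Fubini for an independent pair with one discrete component: restricted to the event
  \<open>Z = z\<close>, the image of \<open>M\<close> under \<open>Y\<close> is
  \<open>pmf p z\<close> times the law of \<open>Y\<close>.\<close>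

lemma nn_integral_indep_discrete:
  fixes p :: "'z pmf" and g :: "'z \<Rightarrow> 'y \<Rightarrow> ennreal"
  assumes AE: "AE \<omega> in M. Z \<omega> \<in> set_pmf p"
    and Z: "\<And>z. z \<in> set_pmf p \<Longrightarrow> {\<omega> \<in> space M. Z \<omega> = z} \<in> sets M"
    and Y: "Y \<in> measurable M N"
    and indep: "\<And>z A. z \<in> set_pmf p \<Longrightarrow> A \<in> sets N \<Longrightarrow>
      emeasure M ((Y -` A \<inter> space M) \<inter> {\<omega> \<in> space M. Z \<omega> = z})
      = emeasure M (Y -` A \<inter> space M) * ennreal (pmf p z)"
    and g: "\<And>z. z \<in> set_pmf p \<Longrightarrow> g z \<in> borel_measurable N"
  shows "(\<integral>\<^sup>+\<omega>. g (Z \<omega>) (Y \<omega>) \<partial>M) = (\<integral>\<^sup>+\<omega>. (\<integral>\<^sup>+z. g z (Y \<omega>) \<partial>p) \<partial>M)"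
proof -
  define E where "E z = {\<omega> \<in> space M. Z \<omega> = z}" for z
  have E: "E z \<in> sets M" if "z \<in> set_pmf p" for z
    using Z[OF that] by (simp add: E_def)
  have gY: "(\<lambda>\<omega>. g z (Y \<omega>)) \<in> borel_measurable M" if "z \<in> set_pmf p" for z
    using measurable_compose[OF Y g[OF that]] .
  have slice: "(\<integral>\<^sup>+\<omega>. g z (Y \<omega>) * indicator (E z) \<omega> \<partial>M) = (\<integral>\<^sup>+\<omega>. ennreal (pmf p z) * g z (Y \<omega>) \<partial>M)"
    if z: "z \<in> set_pmf p" for z
  proof -
    note [measurable] = E[OF z] gY[OF z] Y g[OF z]
    have "distr (density M (indicator (E z))) N Y = density (distr M N Y) (\<lambda>_. ennreal (pmf p z))"
    proof (rule measure_eqI)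
      fix A assume "A \<in> sets (distr (density M (indicator (E z))) N Y)"
      then have A[measurable]: "A \<in> sets N" by simp
      have "emeasure (distr (density M (indicator (E z))) N Y) A
          = emeasure (density M (indicator (E z))) (Y -` A \<inter> space M)"
        by (subst emeasure_distr) auto
      also have "\<dots> = emeasure M ((Y -` A \<inter> space M) \<inter> E z)"
        by (subst emeasure_restricted) (auto simp: Int_commute)
      also have "\<dots> = emeasure M (Y -` A \<inter> space M) * ennreal (pmf p z)"
        unfolding E_def by (rule indep[OF z A])
      also have "\<dots> = emeasure (density (distr M N Y) (\<lambda>_. ennreal (pmf p z))) A"
        using Y A by (simp add: emeasure_density nn_integral_cmult_indicator emeasure_distr)
          (simp add: mult.commute)
      finally show "emeasure (distr (density M (indicator (E z))) N Y) A
          = emeasure (density (distr M N Y) (\<lambda>_. ennreal (pmf p z))) A" .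
    qed simp
    then have "(\<integral>\<^sup>+y. g z y \<partial>distr (density M (indicator (E z))) N Y)
        = (\<integral>\<^sup>+y. g z y \<partial>density (distr M N Y) (\<lambda>_. ennreal (pmf p z)))"
      by (rule arg_cong)
    also have "(\<integral>\<^sup>+y. g z y \<partial>distr (density M (indicator (E z))) N Y)
        = (\<integral>\<^sup>+\<omega>. g z (Y \<omega>) * indicator (E z) \<omega> \<partial>M)"
      by (subst nn_integral_distr) (auto simp: nn_integral_density mult.commute)
    also have "(\<integral>\<^sup>+y. g z y \<partial>density (distr M N Y) (\<lambda>_. ennreal (pmf p z)))
        = (\<integral>\<^sup>+\<omega>. ennreal (pmf p z) * g z (Y \<omega>) \<partial>M)"
      by (subst nn_integral_density) (auto simp: nn_integral_distr)
    finally show ?thesis .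
  qed
  \<comment> \<open>Decomposition along the countably many values of \<open>Z\<close>; almost surely
    exactly one indicator is nonzero.\<close>
  have "AE \<omega> in M. g (Z \<omega>) (Y \<omega>) = (\<integral>\<^sup>+z. g z (Y \<omega>) * indicator (E z) \<omega> \<partial>count_space (set_pmf p))"
    using AE AE_space
  proof eventually_elim
    case (elim \<omega>)
    have "(\<integral>\<^sup>+z. g z (Y \<omega>) * indicator (E z) \<omega> \<partial>count_space (set_pmf p))
        = (\<integral>\<^sup>+z. g z (Y \<omega>) * indicator {Z \<omega>} z \<partial>count_space (set_pmf p))"
      using elim by (intro nn_integral_cong) (auto simp: E_def split: split_indicator)
    also have "\<dots> = g (Z \<omega>) (Y \<omega>)"
      using elim by (subst nn_integral_indicator_singleton) auto
    finally show ?case ..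
  qed
  then have "(\<integral>\<^sup>+\<omega>. g (Z \<omega>) (Y \<omega>) \<partial>M)
      = (\<integral>\<^sup>+\<omega>. (\<integral>\<^sup>+z. g z (Y \<omega>) * indicator (E z) \<omega> \<partial>count_space (set_pmf p)) \<partial>M)"
    by (rule nn_integral_cong_AE)
  also have "\<dots> = (\<integral>\<^sup>+z. (\<integral>\<^sup>+\<omega>. g z (Y \<omega>) * indicator (E z) \<omega> \<partial>M) \<partial>count_space (set_pmf p))"
    using gY E by (intro nn_integral_count_space_nn_integral) auto
  also have "\<dots> = (\<integral>\<^sup>+z. (\<integral>\<^sup>+\<omega>. ennreal (pmf p z) * g z (Y \<omega>) \<partial>M) \<partial>count_space (set_pmf p))"
    by (rule nn_integral_cong) (simp add: slice)
  also have "\<dots> = (\<integral>\<^sup>+\<omega>. (\<integral>\<^sup>+z. ennreal (pmf p z) * g z (Y \<omega>) \<partial>count_space (set_pmf p)) \<partial>M)"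
    using gY by (intro nn_integral_count_space_nn_integral[symmetric]) auto
  also have "\<dots> = (\<integral>\<^sup>+\<omega>. (\<integral>\<^sup>+z. g z (Y \<omega>) \<partial>p) \<partial>M)"
    unfolding nn_integral_measure_pmf
    by (intro nn_integral_cong nn_integral_count_space_eq) (auto simp: set_pmf_iff)
  finally show ?thesis .
qed

section \<open>Laws of the draws and the clipped copy of the process\<close>

lemma has_pmf_prob:
  assumes "has_pmf M X p"
  shows "measure M {\<omega> \<in> space M. X \<omega> = x} = pmf p x"
proof -
  have "pmf p x = measure (distr M (count_space UNIV) X) {x}"
    using assms by (simp add: has_pmf_def measure_pmf_single)
  also have "\<dots> = measure M (X -` {x} \<inter> space M)"
    using assms by (intro measure_distr) (auto simp: has_pmf_def)
  also have "X -` {x} \<inter> space M = {\<omega> \<in> space M. X \<omega> = x}"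
    by auto
  finally show ?thesis ..
qed

lemma has_pmf_AE:
  assumes "has_pmf M X p"
  shows "AE \<omega> in M. X \<omega> \<in> set_pmf p"
proof -
  have "AE x in distr M (count_space UNIV) X. x \<in> set_pmf p"
    using assms AE_measure_pmf[of p] by (metis has_pmf_def)
  then show ?thesis
    using assms by (subst (asm) AE_distr_iff) (auto simp: has_pmf_def)
qed

text \<open>The clipped draws agree almost surely with the original ones. Clipping is needed for
  measurability: off the valid batches, \<open>batch_grad\<close> may involve non-measurable junk.\<close>

definition clip :: "nat \<Rightarrow> nat \<Rightarrow> nat set \<Rightarrow> nat set" where
  "clip n k S = (if S \<in> set_pmf (uniform_subset n k) then S else {})"

lemma clip_subset: "k \<le> n \<Longrightarrow> clip n k S \<subseteq> {1..n}"
  by (auto simp: clip_def set_pmf_uniform_subset)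

lemma measurable_of_vimage_algebra:
  assumes "sets (vimage_algebra (space M) X K) \<subseteq> sets P" "space P = space M" "X \<in> space M \<rightarrow> space K"
  shows "X \<in> measurable P K"
proof (rule measurableI)
  fix A assume "A \<in> sets K"
  then have "X -` A \<inter> space M \<in> sets (vimage_algebra (space M) X K)"
    by (rule in_vimage_algebra)
  then show "X -` A \<inter> space P \<in> sets P"
    using assms by auto
qed (use assms in auto)

lemma pmf_mini_pmf:
  assumes "\<And>i. k \<le> i \<Longrightarrow> R i = {}"
  shows "pmf (mini_pmf n c k) R = (\<Prod>i<k. pmf (uniform_subset n c) (R i))"
  unfolding mini_pmf_def using assms by (intro pmf_Pi') auto

lemma set_pmf_mini_pmf_outside:
  assumes "R \<in> set_pmf (mini_pmf n c k)" "k \<le> i"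
  shows "R i = {}"
proof -
  have "set_pmf (mini_pmf n c k) \<subseteq> {f. \<forall>x. x \<notin> {..<k} \<longrightarrow> f x = {}}"
    unfolding mini_pmf_def by (rule set_Pi_pmf_subset) simp
  then have "\<forall>x. x \<notin> {..<k} \<longrightarrow> R x = {}"
    using assms(1) by (rule CollectD[OF subsetD])
  then show ?thesis
    using assms(2) by simp
qed

lemma vimage_algebra_event: "{\<omega> \<in> \<Omega>. X \<omega> = x} \<in> sets (vimage_algebra \<Omega> X (count_space UNIV))"
  using in_vimage_algebra[of "{x}" "count_space UNIV" X \<Omega>]
  by (simp add: vimage_def Int_def conj_commute)

lemma vimage_algebra_subset_Pow: "sets (vimage_algebra \<Omega> X K) \<subseteq> Pow \<Omega>"
  using sets.space_closed[of "vimage_algebra \<Omega> X K"] by simp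

locale scsg_process =
  fixes M :: "'w measure" and n :: nat and B :: "nat \<Rightarrow> nat" and m :: "nat \<Rightarrow> real"
    and b :: "nat \<Rightarrow> nat" and T :: nat and X0 :: "'w \<Rightarrow> 'a::euclidean_space"
    and I :: "nat \<Rightarrow> 'w \<Rightarrow> nat set" and N :: "nat \<Rightarrow> 'w \<Rightarrow> nat" and J :: "nat \<Rightarrow> nat \<Rightarrow> 'w \<Rightarrow> nat set"
    and f :: "nat \<Rightarrow> 'a \<Rightarrow> real" and \<eta> :: "nat \<Rightarrow> real"
  assumes draws: "scsg_draws M n B m b T X0 I N J"
    and B_le: "\<And>j. j \<in> {1..T} \<Longrightarrow> B j \<le> n"
    and b_le: "\<And>j. b j \<le> n"
    and borel_measurable_batch_grad: "\<And>S. S \<subseteq> {1..n} \<Longrightarrow> batch_grad f S \<in> borel_measurable borel"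
begin

sublocale prob_space M
  using draws by (simp add: scsg_draws_def)

abbreviation "\<gamma> j \<equiv> m j / (m j + real (b j))"
abbreviation "E \<equiv> draw_events M X0 I N J"

definition iterate :: "nat \<Rightarrow> 'w \<Rightarrow> 'a" where
  "iterate j \<omega> = scsg f \<eta> (X0 \<omega>) (\<lambda>j. I j \<omega>) (\<lambda>j. N j \<omega>) (\<lambda>j k. J j k \<omega>) j"

definition clipped :: "nat \<Rightarrow> 'w \<Rightarrow> 'a" where
  "clipped j \<omega> = scsg f \<eta> (X0 \<omega>) (\<lambda>j. clip n (B j) (I j \<omega>)) (\<lambda>j. N j \<omega>)
     (\<lambda>j k. clip n (b j) (J j k \<omega>)) j"

text \<open>The natural filtration of the algorithm, generated by the start and by all draws of the
  first \<open>j\<close> epochs, whether looked at or not.\<close>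

definition past :: "nat \<Rightarrow> 'w measure" where
  "past j = sigma (space M) (\<Union>d\<in>draws_upto j. E d)"

text \<open>Mini-batches that are not looked at are reset to \<open>{}\<close>, which puts the value
  almost surely into the support of \<open>epoch_pmf\<close>.\<close>

definition draw_of_epoch :: "nat \<Rightarrow> 'w \<Rightarrow> epoch_draw" where
  "draw_of_epoch j \<omega> = (I j \<omega>, N j \<omega>, \<lambda>i. if i < N j \<omega> then J j i \<omega> else {})"

lemma
  assumes "j \<in> {1..T}"
  shows pmf_I: "has_pmf M (I j) (uniform_subset n (B j))"
    and pmf_N: "has_pmf M (N j) (Geom (\<gamma> j))"
    and pmf_J: "has_pmf M (J j k) (uniform_subset n (b j))"
  using draws assms by (auto simp: scsg_draws_def)

lemma indep: "indep_sets E (draws_upto T)"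
  using draws by (simp add: scsg_draws_def)

lemma draw_events_subset: "d \<in> draws_upto T \<Longrightarrow> E d \<subseteq> sets M"
  using indep by (auto simp: indep_sets_def)

lemma draw_events_subset_Pow: "E d \<subseteq> Pow (space M)"
  by (cases d) (simp_all add: vimage_algebra_subset_Pow)

lemma Int_stable_draw_events: "Int_stable (E d)"
  by (cases d) (auto intro!: Int_stableI)

lemma draws_upto_mono: "i \<le> j \<Longrightarrow> draws_upto i \<subseteq> draws_upto j"
  by (auto simp: draws_upto_def)

lemma space_past: "space (past j) = space M"
  using draw_events_subset_Pow unfolding past_def by (intro space_measure_of) blast

lemma sets_past: "sets (past j) = sigma_sets (space M) (\<Union>d\<in>draws_upto j. E d)"
  using draw_events_subset_Pow unfolding past_def by (intro sets_measure_of) blast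

lemma draw_events_past: "d \<in> draws_upto j \<Longrightarrow> E d \<subseteq> sets (past j)"
  unfolding sets_past by (auto intro: sigma_sets.Basic)

lemma sets_past_mono:
  assumes "i \<le> j"
  shows "sets (past i) \<subseteq> sets (past j)"
  using draws_upto_mono[OF assms] unfolding sets_past by (intro sigma_sets_mono') blast

lemma sets_past_le:
  assumes "j \<le> T"
  shows "sets (past j) \<subseteq> sets M"
proof -
  have "(\<Union>d\<in>draws_upto j. E d) \<subseteq> sets M"
    using draw_events_subset draws_upto_mono[OF assms] by blast
  then show ?thesis
    unfolding sets_past by (rule sets.sigma_sets_subset)
qed

lemma measurable_past:
  assumes "sets (vimage_algebra (space M) X K) = E d" "d \<in> draws_upto j" "X \<in> space M \<rightarrow> space K"
  shows "X \<in> measurable (past j) K"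
  using draw_events_past[OF assms(2)] assms(1,3)
  by (intro measurable_of_vimage_algebra[where M = M]) (simp_all add: space_past)

lemma measurable_X0: "X0 \<in> borel_measurable (past j)"
  by (rule measurable_past[of _ _ Start]) (auto simp: draws_upto_def)

lemma
  assumes "i \<in> {1..j}"
  shows measurable_I: "I i \<in> measurable (past j) (count_space UNIV)"
    and measurable_N: "N i \<in> measurable (past j) (count_space UNIV)"
    and measurable_J: "J i k \<in> measurable (past j) (count_space UNIV)"
  using assms by (auto intro: measurable_past[of _ _ "Batch i"] measurable_past[of _ _ "Steps i"]
      measurable_past[of _ _ "Mini i k"] simp: draws_upto_def)

lemma measurable_clip:
  assumes "X \<in> measurable P (count_space UNIV)" "k \<le> n"
  shows "(\<lambda>\<omega>. clip n k (X \<omega>)) \<in> measurable P (count_space (Pow {1..n}))"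
proof -
  have "clip n k \<in> measurable (count_space UNIV) (count_space (Pow {1..n}))"
    using clip_subset[OF assms(2)] by auto
  then show ?thesis
    using measurable_compose[OF assms(1)] by blast
qed

lemma measurable_batch_grad_random:
  assumes "Y \<in> borel_measurable P" "S \<in> measurable P (count_space (Pow {1..n}))"
  shows "(\<lambda>\<omega>. batch_grad f (S \<omega>) (Y \<omega>)) \<in> borel_measurable P"
proof (rule measurable_compose_countable'[where g = S and I = "Pow {1..n}"])
  fix A assume "A \<in> Pow {1..n}"
  then show "(\<lambda>\<omega>. batch_grad f A (Y \<omega>)) \<in> borel_measurable P"
    by (intro measurable_compose[OF assms(1)] borel_measurable_batch_grad) simp
qed (use assms in \<open>auto intro: countable_finite\<close>)

lemma measurable_scsg_inner:
  assumes [measurable]: "Y \<in> borel_measurable P"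
    and S: "S \<in> measurable P (count_space (Pow {1..n}))"
    and R: "\<And>i. i < k \<Longrightarrow> R i \<in> measurable P (count_space (Pow {1..n}))"
  shows "(\<lambda>\<omega>. scsg_inner f e (Y \<omega>) (S \<omega>) (\<lambda>i. R i \<omega>) k) \<in> borel_measurable P"
  using R
proof (induction k)
  case 0
  then show ?case by simp
next
  case (Suc k)
  then have [measurable]: "(\<lambda>\<omega>. scsg_inner f e (Y \<omega>) (S \<omega>) (\<lambda>i. R i \<omega>) k) \<in> borel_measurable P"
    by simp
  have "R k \<in> measurable P (count_space (Pow {1..n}))"
    using Suc by simp
  note [measurable] = measurable_batch_grad_random[OF _ this] measurable_batch_grad_random[OF _ S]
  show ?case
    by (simp add: Let_def)
qed

lemma clipped_Suc:
  "clipped (Suc j) \<omega> = scsg_inner f (\<eta> (Suc j)) (clipped j \<omega>) (clip n (B (Suc j)) (I (Suc j) \<omega>))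
     (\<lambda>k. clip n (b (Suc j)) (J (Suc j) k \<omega>)) (N (Suc j) \<omega>)"
  by (simp add: clipped_def)

text \<open>Only countably many numbers of inner steps occur, so measurability for each fixed number
  suffices.\<close>

lemma measurable_clipped: "j \<le> T \<Longrightarrow> clipped j \<in> borel_measurable (past j)"
proof (induction j)
  case 0
  then show ?case
    using measurable_X0[of 0] by (simp add: clipped_def[abs_def])
next
  case (Suc j)
  let ?P = "past (Suc j)"
  have "clipped j \<in> borel_measurable ?P"
    using Suc sets_past_mono[of j "Suc j"] space_past by (auto simp: measurable_def)
  then have "(\<lambda>\<omega>. scsg_inner f (\<eta> (Suc j)) (clipped j \<omega>) (clip n (B (Suc j)) (I (Suc j) \<omega>))
      (\<lambda>i. clip n (b (Suc j)) (J (Suc j) i \<omega>)) k) \<in> borel_measurable ?P" for k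
    using Suc.prems B_le b_le by (intro measurable_scsg_inner measurable_clip measurable_I measurable_J) auto
  then show ?case
    unfolding clipped_Suc[abs_def] using measurable_N[of "Suc j" "Suc j"]
    by (rule measurable_compose_countable[where g = "N (Suc j)"]) auto
qed

lemma draws_valid_AE:
  "AE \<omega> in M. \<forall>j\<in>{1..T}. I j \<omega> \<in> set_pmf (uniform_subset n (B j))
     \<and> N j \<omega> \<in> set_pmf (Geom (\<gamma> j)) \<and> (\<forall>k. J j k \<omega> \<in> set_pmf (uniform_subset n (b j)))"
proof (intro AE_ball_countable')
  fix j assume j: "j \<in> {1..T}"
  have "AE \<omega> in M. \<forall>k. J j k \<omega> \<in> set_pmf (uniform_subset n (b j))"
    using has_pmf_AE[OF pmf_J[OF j]] by (simp add: AE_all_countable)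
  then show "AE \<omega> in M. I j \<omega> \<in> set_pmf (uniform_subset n (B j))
     \<and> N j \<omega> \<in> set_pmf (Geom (\<gamma> j)) \<and> (\<forall>k. J j k \<omega> \<in> set_pmf (uniform_subset n (b j)))"
    using has_pmf_AE[OF pmf_I[OF j]] has_pmf_AE[OF pmf_N[OF j]] by eventually_elim simp
qed simp

lemma iterate_eq_clipped_AE: "AE \<omega> in M. \<forall>j\<le>T. iterate j \<omega> = clipped j \<omega>"
  using draws_valid_AE
proof eventually_elim
  case (elim \<omega>)
  have "iterate j \<omega> = clipped j \<omega>" if "j \<le> T" for j
    using that
  proof (induction j)
    case (Suc j)
    then have "j \<le> T" "Suc j \<in> {1..T}" by auto
    with Suc elim show ?case
      by (simp add: iterate_def clipped_def clip_def)
  qed (simp add: iterate_def clipped_def)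
  then show ?case by blast
qed

lemma draw_of_epoch_AE:
  assumes "j \<in> {1..T}"
  shows "AE \<omega> in M. draw_of_epoch j \<omega> \<in> set_pmf (epoch_pmf n (B j) (b j) (\<gamma> j))"
  using draws_valid_AE
proof eventually_elim
  case (elim \<omega>)
  then show ?case
    using assms by (auto simp: set_pmf_iff draw_of_epoch_def pmf_epoch_pmf pmf_mini_pmf)
qed

lemma draw_of_epoch_event:
  fixes S k R
  defines "C \<equiv> \<lambda>j d. case d of Batch _ \<Rightarrow> {\<omega> \<in> space M. I j \<omega> = S} | Steps _ \<Rightarrow> {\<omega> \<in> space M. N j \<omega> = k}
      | Mini _ i \<Rightarrow> {\<omega> \<in> space M. J j i \<omega> = R i} | Start \<Rightarrow> space M"
  assumes z: "\<And>i. k \<le> i \<Longrightarrow> R i = {}"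
  shows "{\<omega> \<in> space M. draw_of_epoch j \<omega> = (S, k, R)}
      = (\<Inter>d\<in>{Batch j, Steps j} \<union> Mini j ` {..<k}. C j d)" (is ?eq)
    and "d \<in> {Batch j, Steps j} \<union> Mini j ` {..<k} \<Longrightarrow> C j d \<in> E d"
proof -
  have "(\<lambda>i. if i < k then J j i \<omega> else {}) = R \<longleftrightarrow> (\<forall>i<k. J j i \<omega> = R i)" for \<omega>
    using z by (auto simp: fun_eq_iff not_less)
  then show ?eq
    by (auto simp: draw_of_epoch_def C_def)
  show "d \<in> {Batch j, Steps j} \<union> Mini j ` {..<k} \<Longrightarrow> C j d \<in> E d"
    by (auto simp: C_def vimage_algebra_event)
qed

text \<open>The draws of epoch \<open>Suc j\<close> and those generating \<open>past j\<close> have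
  disjoint indices. Independence enters twice: within the epoch it gives the product form of the
  probability, and between the two blocks it separates the epoch from the past.\<close>

lemma draw_of_epoch_indep:
  assumes j: "Suc j \<le> T" and A: "A \<in> sets (past j)"
    and z: "z \<in> set_pmf (epoch_pmf n (B (Suc j)) (b (Suc j)) (\<gamma> (Suc j)))"
  shows "{\<omega> \<in> space M. draw_of_epoch (Suc j) \<omega> = z} \<in> sets M"
    and "prob (A \<inter> {\<omega> \<in> space M. draw_of_epoch (Suc j) \<omega> = z})
      = prob A * pmf (epoch_pmf n (B (Suc j)) (b (Suc j)) (\<gamma> (Suc j))) z"
proof -
  obtain S k R where z_eq: "z = (S, k, R)"
    by (cases z)
  let ?s = "Suc j"
  have s: "?s \<in> {1..T}" using j by simp
  have "R \<in> set_pmf (mini_pmf n (b ?s) k)"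
    using z by (auto simp: z_eq set_pmf_iff pmf_epoch_pmf)
  then have R: "R i = {}" if "k \<le> i" for i
    using that by (rule set_pmf_mini_pmf_outside)
  define D where "D = {Batch ?s, Steps ?s} \<union> Mini ?s ` {..<k}"
  define C where "C d = (case d of Batch _ \<Rightarrow> {\<omega> \<in> space M. I ?s \<omega> = S} | Steps _ \<Rightarrow> {\<omega> \<in> space M. N ?s \<omega> = k}
      | Mini _ i \<Rightarrow> {\<omega> \<in> space M. J ?s i \<omega> = R i} | Start \<Rightarrow> space M)" for d
  define Ev where "Ev = {\<omega> \<in> space M. draw_of_epoch ?s \<omega> = z}"
  have Ev: "Ev = (\<Inter>d\<in>D. C d)"
    using draw_of_epoch_event(1)[where k = k and S = S and R = R and j = ?s] R
    by (simp only: Ev_def D_def C_def z_eq)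
  have C: "C d \<in> E d" if "d \<in> D" for d
    using draw_of_epoch_event(2)[where k = k and S = S and R = R and j = ?s and d = d] R that
    by (simp only: D_def C_def)
  have D: "D \<subseteq> draws_upto T" "finite D" "D \<noteq> {}" "D \<inter> draws_upto j = {}"
    using s by (auto simp: D_def draws_upto_def)
  have "prob Ev = (\<Prod>d\<in>D. prob (C d))"
    unfolding Ev using C D by (intro indep_setsD[OF indep]) auto
  also have "\<dots> = prob {\<omega> \<in> space M. I ?s \<omega> = S} * (prob {\<omega> \<in> space M. N ?s \<omega> = k}
      * (\<Prod>i<k. prob {\<omega> \<in> space M. J ?s i \<omega> = R i}))"
  proof -
    have "Batch ?s \<notin> insert (Steps ?s) (Mini ?s ` {..<k})" "Steps ?s \<notin> Mini ?s ` {..<k}"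
      "inj_on (Mini ?s) {..<k}"
      by (auto simp: inj_on_def)
    then show ?thesis
      by (simp add: D_def C_def prod.reindex)
  qed
  also have "\<dots> = pmf (epoch_pmf n (B ?s) (b ?s) (\<gamma> ?s)) z"
    using R by (simp add: z_eq pmf_epoch_pmf pmf_mini_pmf has_pmf_prob[OF pmf_I[OF s]]
        has_pmf_prob[OF pmf_N[OF s]] has_pmf_prob[OF pmf_J[OF s]])
  finally have prob_Ev: "prob Ev = pmf (epoch_pmf n (B ?s) (b ?s) (\<gamma> ?s)) z" .
  have "C d \<in> sets M" if "d \<in> D" for d
    using C that D draw_events_subset by blast
  then show "{\<omega> \<in> space M. draw_of_epoch ?s \<omega> = z} \<in> sets M"
    unfolding Ev_def[symmetric] Ev using D by (intro sets.finite_INT) auto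
  \<comment> \<open>Two disjoint blocks of draws; the sigma-algebras they generate are independent
    because every \<open>E d\<close> is closed under intersection.\<close>
  define K where "K = case_bool (draws_upto j) D"
  have "indep_sets (\<lambda>i. sigma_sets (space M) (\<Union>d\<in>K i. E d)) UNIV"
  proof (rule indep_sets_collect_sigma)
    have "(\<Union>i. K i) \<subseteq> draws_upto T"
      using D draws_upto_mono[of j T] j by (auto simp: K_def split: bool.splits)
    then show "indep_sets E (\<Union>i. K i)"
      using indep by (rule indep_sets_mono_index)
    show "disjoint_family_on K UNIV"
      using D by (auto simp: disjoint_family_on_def K_def split: bool.splits)
  qed (rule Int_stable_draw_events)
  then have "prob (\<Inter>i\<in>UNIV. case_bool A Ev i) = (\<Prod>i\<in>UNIV. prob (case_bool A Ev i))"
  proof (rule indep_setsD)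
    have "C d \<in> sigma_sets (space M) (\<Union>d\<in>D. E d)" if "d \<in> D" for d
      using C that by (intro sigma_sets.Basic) blast
    moreover have "(\<Union>d\<in>D. E d) \<subseteq> Pow (space M)"
      using draw_events_subset_Pow by blast
    ultimately have "C d \<in> sets (sigma (space M) (\<Union>d\<in>D. E d))" if "d \<in> D" for d
      using that by simp
    then have "Ev \<in> sets (sigma (space M) (\<Union>d\<in>D. E d))"
      unfolding Ev using D by (intro sets.finite_INT) auto
    then have "Ev \<in> sigma_sets (space M) (\<Union>d\<in>D. E d)"
      using \<open>(\<Union>d\<in>D. E d) \<subseteq> Pow (space M)\<close> by simp
    then show "\<forall>i\<in>UNIV. case_bool A Ev i \<in> sigma_sets (space M) (\<Union>d\<in>K i. E d)"
      using A by (auto simp: K_def sets_past split: bool.splits)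
  qed auto
  then show "prob (A \<inter> {\<omega> \<in> space M. draw_of_epoch ?s \<omega> = z})
      = prob A * pmf (epoch_pmf n (B ?s) (b ?s) (\<gamma> ?s)) z"
    by (simp add: UNIV_bool prob_Ev Ev_def[symmetric] Int_commute mult.commute)
qed

lemma iterate_Suc: "iterate (Suc j) \<omega> = epoch f (\<eta> (Suc j)) (iterate j \<omega>) (draw_of_epoch (Suc j) \<omega>)"
  unfolding iterate_def draw_of_epoch_def epoch_def scsg.simps prod.case
  by (rule scsg_inner_cong) simp

lemma borel_measurable_epoch:
  assumes "z \<in> set_pmf (epoch_pmf n c d g)" "c \<le> n" "d \<le> n"
  shows "(\<lambda>x. epoch f e x z) \<in> borel_measurable borel"
proof -
  obtain S k R where z: "z = (S, k, R)"
    by (cases z)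
  have "pmf (uniform_subset n c) S \<noteq> 0" and R: "R \<in> set_pmf (mini_pmf n d k)"
    using assms(1) by (auto simp: z set_pmf_iff pmf_epoch_pmf)
  then have S: "S \<subseteq> {1..n}"
    using set_pmf_uniform_subset[OF assms(2)] by (auto simp: set_pmf_iff[symmetric])
  have "R i \<subseteq> {1..n}" if "i < k" for i
  proof -
    have "(\<Prod>i<k. pmf (uniform_subset n d) (R i)) \<noteq> 0"
      using R set_pmf_mini_pmf_outside[OF R] by (simp add: set_pmf_iff pmf_mini_pmf)
    then have "R i \<in> set_pmf (uniform_subset n d)"
      using that by (simp add: set_pmf_iff)
    then show ?thesis
      using set_pmf_uniform_subset[OF assms(3)] by auto
  qed
  then show ?thesis
    using S unfolding z epoch_def prod.case
    by (intro measurable_scsg_inner) auto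
qed

lemma nn_integral_iterate:
  fixes h :: "'a \<Rightarrow> ennreal"
  assumes "j \<le> T"
  shows "(\<integral>\<^sup>+\<omega>. h (iterate j \<omega>) \<partial>M) = (\<integral>\<^sup>+\<omega>. h (clipped j \<omega>) \<partial>M)"
  using iterate_eq_clipped_AE assms
  by (intro nn_integral_cong_AE) (auto elim!: eventually_mono)

lemma measurable_clipped_M: "j \<le> T \<Longrightarrow> clipped j \<in> borel_measurable M"
  using measurable_clipped[of j] sets_past_le[of j] space_past by (auto simp: measurable_def)

text \<open>The Markov property. The recursion is available for \<open>iterate\<close>,
  measurability with respect to the past for \<open>clipped\<close>; the proof moves between the
  two, which agree almost surely.\<close>

lemma epoch_law:
  fixes h :: "'a \<Rightarrow> ennreal"
  assumes j: "Suc j \<le> T" and h: "h \<in> borel_measurable borel"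
  shows "(\<integral>\<^sup>+\<omega>. h (clipped (Suc j) \<omega>) \<partial>M)
    = (\<integral>\<^sup>+\<omega>. (\<integral>\<^sup>+z. h (epoch f (\<eta> (Suc j)) (clipped j \<omega>) z)
        \<partial>epoch_pmf n (B (Suc j)) (b (Suc j)) (\<gamma> (Suc j))) \<partial>M)"
proof -
  let ?p = "epoch_pmf n (B (Suc j)) (b (Suc j)) (\<gamma> (Suc j))"
  let ?g = "\<lambda>z x. h (epoch f (\<eta> (Suc j)) x z)"
  have s: "Suc j \<in> {1..T}" using j by simp
  have Y: "clipped j \<in> measurable (past j) borel"
    using j by (intro measurable_clipped) simp
  have "(\<integral>\<^sup>+\<omega>. h (clipped (Suc j) \<omega>) \<partial>M) = (\<integral>\<^sup>+\<omega>. h (iterate (Suc j) \<omega>) \<partial>M)"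
    using j by (intro nn_integral_iterate[symmetric])
  also have "\<dots> = (\<integral>\<^sup>+\<omega>. ?g (draw_of_epoch (Suc j) \<omega>) (clipped j \<omega>) \<partial>M)"
    using iterate_eq_clipped_AE j
    by (intro nn_integral_cong_AE) (auto simp: iterate_Suc elim!: eventually_mono)
  also have "\<dots> = (\<integral>\<^sup>+\<omega>. (\<integral>\<^sup>+z. ?g z (clipped j \<omega>) \<partial>?p) \<partial>M)"
  proof (rule nn_integral_indep_discrete[where Z = "draw_of_epoch (Suc j)" and Y = "clipped j" and N = borel
        and g = ?g])
    show "AE \<omega> in M. draw_of_epoch (Suc j) \<omega> \<in> set_pmf ?p"
      by (rule draw_of_epoch_AE[OF s])
    show "clipped j \<in> borel_measurable M"
      using j by (intro measurable_clipped_M) simp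
    fix z assume z: "z \<in> set_pmf ?p"
    show "{\<omega> \<in> space M. draw_of_epoch (Suc j) \<omega> = z} \<in> sets M"
      using draw_of_epoch_indep(1)[OF j _ z] sets.top by blast
    show "(\<lambda>x. ?g z x) \<in> borel_measurable borel"
      using borel_measurable_epoch[OF z] B_le[OF s] b_le h by (intro measurable_compose[OF _ h]) auto
    fix A :: "'a set" assume "A \<in> sets borel"
    then have "clipped j -` A \<inter> space M \<in> sets (past j)"
      using measurable_sets[OF Y] space_past by metis
    then show "emeasure M ((clipped j -` A \<inter> space M) \<inter> {\<omega> \<in> space M. draw_of_epoch (Suc j) \<omega> = z})
        = emeasure M (clipped j -` A \<inter> space M) * ennreal (pmf ?p z)"
      using draw_of_epoch_indep(2)[OF j _ z]
      by (simp add: emeasure_eq_measure ennreal_mult)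
  qed
  finally show ?thesis .
qed

end

section \<open>The recursion over epochs\<close>

context smooth_convex_sum
begin

text \<open>The Young term grows like \<open>1 / \<kappa>\<close>, that is like
  \<open>\<alpha> ^ j\<close>; batches of size of order \<open>\<alpha> ^ (2 * j)\<close> turn this
  into noise of order \<open>1 / \<alpha> ^ j\<close>. The assumption \<open>step\<close> limits the
  part proportional to the gap to \<open>2 * G\<close>.\<close>

lemma batch_noise_le:
  fixes j b B :: nat and \<alpha> m0 \<eta> G :: real
  assumes \<alpha>: "1 < \<alpha>" and pos: "0 < m0" "0 < B0" "0 < \<eta>" "0 < G" "G \<le> 1 / 4" and b: "1 \<le> b"
    and m0: "real b / m0 \<le> G" and step: "2 * \<eta> * L \<le> G\<^sup>2 * real b * B0 / m0"
    and B: "B0 * \<alpha> ^ (2 * j) \<le> real B"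
  defines "\<kappa> \<equiv> real b / (m0 * \<alpha> ^ j)"
  shows "(\<eta> / (2 * \<kappa> * G) + \<eta>) * ((4 * L * (F x - F xs) + 2 * grad_second_moment f n xs) / real B)
    \<le> 2 * G * (F x - F xs) + 2 * \<eta> * m0 / (G * real b * B0) * grad_second_moment f n xs / \<alpha> ^ j"
proof -
  define a where "a = \<alpha> ^ j"
  define H where "H = grad_second_moment f n xs"
  define \<Delta> where "\<Delta> = F x - F xs"
  have a: "1 \<le> a"
    using \<alpha> by (simp add: a_def)
  have nonneg: "0 \<le> H" "0 \<le> \<Delta>"
    using minimal[of x] grad_second_moment_nonneg by (auto simp: H_def \<Delta>_def)
  have \<kappa>: "0 < \<kappa>" "\<kappa> = real b / m0 / a"
    using b pos a by (auto simp: \<kappa>_def a_def)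
  have "\<kappa> \<le> real b / m0 / 1"
    unfolding \<kappa> using a b pos by (intro divide_left_mono) auto
  then have "\<kappa> \<le> G"
    using m0 by simp
  with pos(5) have "\<kappa> \<le> 1 / 4"
    by linarith
  then have "2 * \<kappa> * G \<le> 2 * (1 / 4) * (1 / 4)"
    using \<kappa>(1) pos by (intro mult_mono) auto
  then have "\<eta> * (2 * \<kappa> * G) \<le> \<eta> * 1"
    using pos by (intro mult_left_mono) auto
  \<comment> \<open>As \<open>\<kappa>\<close> and \<open>G\<close> are at most
    \<open>1 / 4\<close>, the bare \<open>\<eta>\<close> is dominated by the Young term.\<close>
  then have "\<eta> \<le> \<eta> / (2 * \<kappa> * G)"
    using pos \<kappa>(1) by (simp add: pos_le_divide_eq)
  then have w: "\<eta> / (2 * \<kappa> * G) + \<eta> \<le> \<eta> / (\<kappa> * G)"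
    by (simp add: field_simps)
  have B': "B0 * a * a \<le> real B" and B_pos: "0 < real B"
    using B pos \<alpha> less_le_trans[of 0 "B0 * \<alpha> ^ (2 * j)" "real B"]
    by (auto simp: a_def mult_2 power_add mult.assoc)
  have "real b / m0 * (B0 * a) = \<kappa> * (B0 * a * a)"
    using a by (simp add: \<kappa>)
  also have "\<dots> \<le> \<kappa> * real B"
    using B' \<kappa> by (intro mult_left_mono) auto
  finally have "1 / (\<kappa> * real B) \<le> 1 / (real b / m0 * (B0 * a))"
    using pos b a \<kappa> B_pos by (intro divide_left_mono mult_pos_pos) auto
  also have "\<dots> = m0 / (real b * B0 * a)"
    using pos b a by simp
  finally have q: "1 / (\<kappa> * real B) \<le> m0 / (real b * B0 * a)" .
  have "(\<eta> / (2 * \<kappa> * G) + \<eta>) * ((4 * L * \<Delta> + 2 * H) / real B)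
      \<le> \<eta> / (\<kappa> * G) * ((4 * L * \<Delta> + 2 * H) / real B)"
    using nonneg L_pos by (intro mult_right_mono w) auto
  also have "\<dots> = \<eta> / G * (4 * L * \<Delta> + 2 * H) * (1 / (\<kappa> * real B))"
    by simp
  also have "\<dots> \<le> \<eta> / G * (4 * L * \<Delta> + 2 * H) * (m0 / (real b * B0 * a))"
    using nonneg L_pos pos by (intro mult_left_mono q) auto
  also have "\<dots> = (2 * \<eta> * L * (m0 / (real b * B0))) * (2 * \<Delta> / G / a) + 2 * \<eta> * m0 / (G * real b * B0) * H / a"
    using pos b a by (simp add: field_simps)
  \<comment> \<open>The step size bound supplies two powers of \<open>G\<close>, one of which
    cancels the \<open>1 / G\<close>.\<close>
  also have "(2 * \<eta> * L * (m0 / (real b * B0))) * (2 * \<Delta> / G / a)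
      \<le> (G\<^sup>2 * real b * B0 / m0 * (m0 / (real b * B0))) * (2 * \<Delta> / G / a)"
    using step pos a nonneg by (intro mult_right_mono) auto
  also have "\<dots> = 2 * G * \<Delta> / a"
    using pos b by (simp add: power2_eq_square)
  also have "\<dots> \<le> 2 * G * \<Delta> / 1"
    using pos a nonneg by (intro divide_left_mono) auto
  finally show ?thesis
    by (simp add: H_def \<Delta>_def a_def)
qed

text \<open>The factor \<open>3 * G\<close> collects \<open>G\<close> from the tangent at
  \<open>x\<close> and \<open>2 * G\<close> from the batch variance.\<close>

lemma epoch_step:
  fixes j b :: nat and \<alpha> m0 \<eta> G :: real
  assumes \<alpha>: "1 < \<alpha>" and pos: "0 < m0" "0 < B0" "0 < \<eta>" "0 < G" "G \<le> 1 / 4" and b: "1 \<le> b" "b \<le> n"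
    and m0: "real b / m0 \<le> G"
    and step: "2 * \<eta> * L \<le> 1 - G" "2 * \<eta> * L \<le> 2 * G * real b" "2 * \<eta> * L \<le> G\<^sup>2 * real b * B0 / m0"
  defines "\<rho> \<equiv> (1 - G) * (real b / (m0 * \<alpha> ^ j)) / (2 * \<eta>)"
  shows "(\<integral>\<^sup>+z. ennreal (lyapunov \<rho> (epoch f \<eta> x z))
      \<partial>epoch_pmf n (nat \<lceil>min (B0 * \<alpha> ^ (2 * j)) (real n)\<rceil>) b (m0 * \<alpha> ^ j / (m0 * \<alpha> ^ j + real b)))
    \<le> ennreal (\<rho> * (norm (x - xs))\<^sup>2 + 3 * G * (F x - F xs)
        + (if B0 * \<alpha> ^ (2 * j) < real n
           then 2 * \<eta> * m0 / (G * real b * B0) * grad_second_moment f n xs / \<alpha> ^ j else 0))"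
proof -
  define B where "B = nat \<lceil>min (B0 * \<alpha> ^ (2 * j)) (real n)\<rceil>"
  define \<kappa> where "\<kappa> = real b / (m0 * \<alpha> ^ j)"
  have m: "0 < m0 * \<alpha> ^ j" and B0: "0 < B0 * \<alpha> ^ (2 * j)"
    using \<alpha> pos by auto
  have "0 < min (B0 * \<alpha> ^ (2 * j)) (real n)"
    using B0 n_pos by simp
  then have "0 < \<lceil>min (B0 * \<alpha> ^ (2 * j)) (real n)\<rceil>"
    by linarith
  moreover have "\<lceil>min (B0 * \<alpha> ^ (2 * j)) (real n)\<rceil> \<le> int n"
    by (simp add: ceiling_le_iff)
  ultimately have B: "1 \<le> B" "B \<le> n"
    unfolding B_def by linarith+
  have B_ge: "min (B0 * \<alpha> ^ (2 * j)) (real n) \<le> real B"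
    unfolding B_def by (rule real_nat_ceiling_ge)
  have \<kappa>: "0 < \<kappa>"
    using m b by (simp add: \<kappa>_def)
  have \<gamma>: "m0 * \<alpha> ^ j / (m0 * \<alpha> ^ j + real b) = 1 / (1 + \<kappa>)"
  proof -
    have "1 + \<kappa> = (m0 * \<alpha> ^ j + real b) / (m0 * \<alpha> ^ j)"
      unfolding \<kappa>_def add_divide_distrib using m by (metis divide_self less_irrefl)
    then show ?thesis by simp
  qed
  \<comment> \<open>Rounding up may give \<open>B = n\<close> while
    \<open>B0 * \<alpha> ^ (2 * j) < real n\<close>; then the left-hand side of \<open>noise\<close>
    is zero and nonnegativity of the right is needed. The opposite mismatch is excluded by
    \<open>B_ge\<close>.\<close>
  have "0 \<le> 2 * \<eta> * m0 / (G * real b * B0) * grad_second_moment f n xs / \<alpha> ^ j"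
    using pos \<alpha> grad_second_moment_nonneg by simp
  moreover have "0 \<le> 2 * G * (F x - F xs)"
    using pos minimal[of x] by simp
  ultimately have noise: "(\<eta> / (2 * \<kappa> * G) + \<eta>) *
        (if B < n then (4 * L * (F x - F xs) + 2 * grad_second_moment f n xs) / real B else 0)
      \<le> 2 * G * (F x - F xs) + (if B0 * \<alpha> ^ (2 * j) < real n
           then 2 * \<eta> * m0 / (G * real b * B0) * grad_second_moment f n xs / \<alpha> ^ j else 0)"
    using batch_noise_le[OF \<alpha> pos b(1) m0 step(3), of j B x, folded \<kappa>_def] B_ge by auto
  have "(\<integral>\<^sup>+z. ennreal (lyapunov \<rho> (epoch f \<eta> x z)) \<partial>epoch_pmf n B b (1 / (1 + \<kappa>)))
      \<le> ennreal (\<rho> * (norm (x - xs))\<^sup>2 + G * (F x - F xs) + (\<eta> / (2 * \<kappa> * G) + \<eta>) *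
        (if B < n then (4 * L * (F x - F xs) + 2 * grad_second_moment f n xs) / real B else 0))"
    unfolding \<rho>_def \<kappa>_def[symmetric] using pos step b B \<kappa> by (intro epoch_bound) auto
  also have "\<dots> \<le> ennreal (\<rho> * (norm (x - xs))\<^sup>2 + 3 * G * (F x - F xs)
        + (if B0 * \<alpha> ^ (2 * j) < real n
           then 2 * \<eta> * m0 / (G * real b * B0) * grad_second_moment f n xs / \<alpha> ^ j else 0))"
    using noise by (intro ennreal_leI) linarith
  finally show ?thesis
    unfolding B_def \<gamma> .
qed

text \<open>Beyond \<open>T\<^sub>\<kappa>\<^sup>*\<close> strong convexity turns the whole squared distance into function value, which
  contracts at the fast rate \<open>4 \<Gamma>\<close>; before, the distance term contracts because \<open>m\<^sub>j\<close> grows.\<close>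

lemma lyapunov_contraction:
  fixes \<alpha> m0 \<eta> \<xi> :: real and b :: nat
  assumes \<alpha>: "1 < \<alpha>" and \<xi>: "0 < \<xi>" "\<xi> < 1" and pos: "0 < m0" "0 < \<eta>" "0 \<le> \<mu>"
    and A2: "assumption_A2 f n xs \<mu>"
    and T\<kappa>: "\<mu> = 0 \<Longrightarrow> T\<kappa> = \<infinity>" "\<mu> \<noteq> 0 \<Longrightarrow> \<exists>t. T\<kappa> = ereal t \<and> \<alpha> powr t = 1 / (\<eta> * \<mu>)"
  defines "G \<equiv> 1 / (4 * \<alpha> powr (1 / \<xi>))"
  defines "\<rho> \<equiv> \<lambda>j. (1 - G) * (real b / (m0 * \<alpha> ^ j)) / (2 * \<eta>)"
  assumes m0: "real b / m0 \<le> G"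
  shows "\<rho> (Suc j) * (norm (x - xs))\<^sup>2 + 3 * G * (F x - F xs)
    \<le> inverse (rate \<alpha> \<xi> T\<kappa> (Suc j)) * lyapunov (\<rho> j) x"
proof -
  define \<Delta> where "\<Delta> = F x - F xs"
  define D where "D = (norm (x - xs))\<^sup>2"
  have nonneg: "0 \<le> \<Delta>" "0 \<le> D"
    using minimal[of x] by (auto simp: \<Delta>_def D_def)
  have "\<alpha> powr 1 \<le> \<alpha> powr (1 / \<xi>)"
    using \<alpha> \<xi> by (intro powr_mono) auto
  then have powr: "\<alpha> \<le> \<alpha> powr (1 / \<xi>)"
    using \<alpha> by simp
  then have G: "0 < G" "4 * G \<le> 1 / \<alpha>" "4 * G = inverse (\<alpha> powr (1 / \<xi>))"
    using \<alpha> by (auto simp: G_def inverse_eq_divide intro!: divide_left_mono)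
  moreover have "1 / \<alpha> \<le> 1"
    using \<alpha> by simp
  ultimately have G1: "G < 1"
    by linarith
  have \<rho>: "0 \<le> \<rho> i" for i
    using G1 pos \<alpha> by (simp add: \<rho>_def)
  show ?thesis
  proof (cases "ereal (real (Suc j)) \<le> T\<kappa>")
    case True
    have "\<rho> (Suc j) = \<rho> j / \<alpha>"
      using \<alpha> by (simp add: \<rho>_def)
    moreover have "3 * G * \<Delta> \<le> 1 / \<alpha> * \<Delta>"
      using G nonneg by (intro mult_right_mono) auto
    ultimately have "\<rho> (Suc j) * D + 3 * G * \<Delta> \<le> \<rho> j / \<alpha> * D + 1 / \<alpha> * \<Delta>"
      by simp
    also have "\<dots> = inverse \<alpha> * (\<Delta> + \<rho> j * D)"
      using \<alpha> by (simp add: field_simps)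
    finally show ?thesis
      using True by (simp add: rate_def lyapunov_def \<Delta>_def D_def)
  next
    case False
    then have "\<mu> \<noteq> 0"
      using T\<kappa>(1) by auto
    then obtain t where t: "T\<kappa> = ereal t" "\<alpha> powr t = 1 / (\<eta> * \<mu>)"
      using T\<kappa>(2) by blast
    have \<mu>: "0 < \<mu>"
      using \<open>\<mu> \<noteq> 0\<close> pos by simp
    have "t < real (Suc j)"
      using False by (simp add: t not_le)
    then have "\<alpha> powr t \<le> \<alpha> powr real (Suc j)"
      using \<alpha> by (intro powr_mono) auto
    also have "\<dots> = \<alpha> ^ Suc j"
      using \<alpha> by (intro powr_realpow) simp
    finally have t_le: "1 / (\<eta> * \<mu>) \<le> \<alpha> ^ Suc j"
      by (simp only: t)
    have "\<mu> / 2 * D \<le> \<Delta>"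
      using A2 by (simp add: assumption_A2_def D_def \<Delta>_def)
    then have D_le: "D \<le> 2 / \<mu> * \<Delta>"
      using \<mu> by (simp add: field_simps)
    have "\<rho> (Suc j) * D \<le> \<rho> (Suc j) * (2 / \<mu> * \<Delta>)"
      by (intro mult_left_mono D_le \<rho>)
    \<comment> \<open>The factors are bounded by 1, \<open>G\<close> and 1, the third because the
      epoch lies beyond \<open>T\<kappa>\<close>. This yields the fourth \<open>G\<close>, without
      touching the old distance \<open>\<rho> j * D\<close>.\<close>
    also have "\<dots> = (1 - G) * (real b / m0) * (1 / (\<eta> * \<mu>) / \<alpha> ^ Suc j) * \<Delta>"
      using pos \<mu> \<alpha> by (simp add: \<rho>_def field_simps)
    also have "\<dots> \<le> 1 * G * 1 * \<Delta>"
      using t_le \<alpha> G G1 m0 pos \<mu> nonneg by (intro mult_mono mult_nonneg_nonneg) (auto simp: divide_le_eq mult_ac)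
    finally have "\<rho> (Suc j) * D + 3 * G * \<Delta> \<le> 4 * G * \<Delta>"
      by simp
    also have "\<dots> \<le> inverse (\<alpha> powr (1 / \<xi>)) * (\<Delta> + \<rho> j * D)"
      unfolding G(3) using \<alpha> \<rho> nonneg by (intro mult_left_mono) auto
    finally show ?thesis
      using False by (simp add: rate_def lyapunov_def \<Delta>_def D_def)
  qed
qed

lemma borel_measurable_lyapunov: "lyapunov \<rho> \<in> borel_measurable borel"
  unfolding lyapunov_def[abs_def]
  by (intro borel_measurable_continuous_onI continuous_intros continuous_on_objective)

end

section \<open>Rates and their products\<close>

lemma rate_pos: "1 < \<alpha> \<Longrightarrow> 0 < rate \<alpha> \<xi> \<tau> j"
  by (simp add: rate_def)

lemma rate_prod_pos: "1 < \<alpha> \<Longrightarrow> 0 < rate_prod \<alpha> \<xi> \<tau> T"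
  by (simp add: rate_prod_def prod_pos rate_pos)

lemma rate_prod_Suc: "rate_prod \<alpha> \<xi> \<tau> (Suc T) = rate_prod \<alpha> \<xi> \<tau> T * rate \<alpha> \<xi> \<tau> (Suc T)"
  by (simp add: rate_prod_def)

text \<open>A later threshold keeps the slow rate longer. Epochs contract at the rate for
  \<open>T\<kappa>\<close>, hence at least as strongly as the tilde rate at which noise is
  accounted.\<close>

lemma rate_antimono:
  assumes "1 < \<alpha>" "0 < \<xi>" "\<xi> < 1" "\<sigma> \<le> \<tau>"
  shows "rate \<alpha> \<xi> \<tau> j \<le> rate \<alpha> \<xi> \<sigma> j"
proof -
  have "\<alpha> powr 1 \<le> \<alpha> powr (1 / \<xi>)"
    using assms by (intro powr_mono) auto
  then show ?thesis
    using assms by (auto simp: rate_def)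
qed

text \<open>Rewrites noise of order \<open>1 / \<alpha> ^ j\<close> as an inverse product of rates;
  a threshold of at least \<open>Tn\<close> covers every noisy epoch.\<close>

lemma rate_prod_initial: "ereal (real T) \<le> \<tau> \<Longrightarrow> rate_prod \<alpha> \<xi> \<tau> T = \<alpha> ^ T"
proof (induction T)
  case 0
  then show ?case by (simp add: rate_prod_def)
next
  case (Suc T)
  have "ereal (real T) \<le> ereal (real (Suc T))"
    by simp
  then have "ereal (real T) \<le> \<tau>"
    using Suc.prems by (rule order_trans)
  then show ?case
    using Suc by (simp add: rate_prod_Suc rate_def)
qed

theorem theorem4p2:
  fixes f :: "nat \<Rightarrow> real ^ 'd \<Rightarrow> real"
    and xs :: "real ^ 'd"
    and n b T :: nat
    and L \<mu> \<alpha> m0 \<xi> \<eta> B0 \<Gamma> Tn :: real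
    and T\<kappa> :: ereal
    and M :: "'w measure"
    and X0 :: "'w \<Rightarrow> real ^ 'd"
    and I :: "nat \<Rightarrow> 'w \<Rightarrow> nat set"
    and N :: "nat \<Rightarrow> 'w \<Rightarrow> nat"
    and J :: "nat \<Rightarrow> nat \<Rightarrow> 'w \<Rightarrow> nat set"
  defines "\<Gamma> \<equiv> 1 / (4 * \<alpha> powr (1 / \<xi>))"
  defines "F \<equiv> objective f n"
  defines "XT \<equiv> (\<lambda>\<omega>. scsg f (\<lambda>j. \<eta>) (X0 \<omega>) (\<lambda>j. I j \<omega>) (\<lambda>j. N j \<omega>) (\<lambda>j k. J j k \<omega>) T)"
  defines "D\<^sub>x \<equiv> ennreal L * (\<integral>\<^sup>+\<omega>. ennreal ((norm (X0 \<omega> - xs))\<^sup>2) \<partial>M)"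
  defines "D\<^sub>H \<equiv> grad_second_moment f n xs / L"
  defines "\<Lambda> \<equiv> rate_prod \<alpha> \<xi> T\<kappa> T"
  defines "\<Lambda>' \<equiv> rate_prod \<alpha> \<xi> (max (ereal Tn) T\<kappa>) T"
  assumes "0 < L" and "0 \<le> \<mu>"
    and "assumption_A1 f n L"
    and "reference_minimizer f n xs"
    and "assumption_A2 f n xs \<mu>"
    and "1 < \<alpha>" and "0 < m0" and "0 < \<xi>" and "\<xi> < 1"
    and "0 < \<eta>" and "b \<in> {1..n}" and "0 < B0"
    and "m0 \<ge> real b / \<Gamma>"
    and "2 * \<eta> * L \<le> Min {1 - \<Gamma>, 2 * \<Gamma> * real b, \<Gamma>\<^sup>2 * real b * B0 / m0}"
    and "0 < T\<kappa>"
    and "\<mu> = 0 \<Longrightarrow> T\<kappa> = \<infinity>"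
    and "\<mu> \<noteq> 0 \<Longrightarrow> \<exists>t. T\<kappa> = ereal t \<and> \<alpha> powr t = 1 / (\<eta> * \<mu>)"
    and "0 < Tn" and "B0 * \<alpha> powr (2 * Tn) = real n"
    and "scsg_draws M n (\<lambda>j. nat \<lceil>min (B0 * \<alpha> ^ (2 * j)) (real n)\<rceil>) (\<lambda>j. m0 * \<alpha> ^ j) (\<lambda>j. b)
           T X0 I N J"
  shows "(\<integral>\<^sup>+\<omega>. ennreal (F (XT \<omega>) - F xs) \<partial>M)
         \<le> ennreal (inverse \<Lambda>) * (D\<^sub>x / ennreal (2 * \<eta> * L))
           + ennreal (inverse \<Lambda>' * (2 * \<eta> * L * m0 / (\<Gamma> * real b * B0)) * D\<^sub>H * min (real T) Tn)"
proof -
  define H where "H = grad_second_moment f n xs"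
  define K where "K = 2 * \<eta> * L * m0 / (\<Gamma> * real b * B0) * D\<^sub>H"
  define \<rho> where "\<rho> j = (1 - \<Gamma>) * (real b / (m0 * \<alpha> ^ j)) / (2 * \<eta>)" for j
  \<comment> \<open>The noise injected by epoch \<open>j\<close>; the condition amounts to
    \<open>j < Tn\<close>.\<close>
  define \<nu> where "\<nu> j = (if B0 * \<alpha> ^ (2 * j) < real n then K / \<alpha> ^ j else 0)" for j
  define \<Lambda>\<^sub>1 where "\<Lambda>\<^sub>1 = rate_prod \<alpha> \<xi> T\<kappa>"
  define \<Lambda>\<^sub>2 where "\<Lambda>\<^sub>2 = rate_prod \<alpha> \<xi> (max (ereal Tn) T\<kappa>)"
  note \<alpha> = \<open>1 < \<alpha>\<close>
  have b: "1 \<le> b" "b \<le> n"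
    using \<open>b \<in> {1..n}\<close> by auto
  have "\<alpha> powr 0 \<le> \<alpha> powr (1 / \<xi>)"
    using \<alpha> \<open>0 < \<xi>\<close> by (intro powr_mono) auto
  then have powr: "1 \<le> \<alpha> powr (1 / \<xi>)"
    using \<alpha> by simp
  have \<Gamma>: "0 < \<Gamma>" "\<Gamma> \<le> 1 / 4"
    using powr frac_le[of 1 1 4 "4 * \<alpha> powr (1 / \<xi>)"] by (auto simp: \<Gamma>_def)
  have m0: "real b / m0 \<le> \<Gamma>"
    using \<open>m0 \<ge> real b / \<Gamma>\<close> \<Gamma> \<open>0 < m0\<close> by (simp add: field_simps)
  have step: "2 * \<eta> * L \<le> 1 - \<Gamma>" "2 * \<eta> * L \<le> 2 * \<Gamma> * real b" "2 * \<eta> * L \<le> \<Gamma>\<^sup>2 * real b * B0 / m0"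
    using \<open>2 * \<eta> * L \<le> Min _\<close> by simp_all
  have minimal: "objective f n xs \<le> objective f n x" for x
    using \<open>reference_minimizer f n xs\<close> by (auto simp: reference_minimizer_def is_arg_min_def not_less)
  interpret smooth_convex_sum f n L xs
    using b \<open>0 < L\<close> \<open>assumption_A1 f n L\<close> minimal by unfold_locales auto
  interpret scsg_process M n "\<lambda>j. nat \<lceil>min (B0 * \<alpha> ^ (2 * j)) (real n)\<rceil>" "\<lambda>j. m0 * \<alpha> ^ j" "\<lambda>j. b"
    T X0 I N J f "\<lambda>j. \<eta>"
  proof unfold_locales
    show "nat \<lceil>min (B0 * \<alpha> ^ (2 * j)) (real n)\<rceil> \<le> n" for j
      by (simp add: nat_le_iff ceiling_le_iff)
    show "batch_grad f S \<in> borel_measurable borel" if "S \<subseteq> {1..n}" for S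
      using that by (intro borel_measurable_continuous_onI continuous_on_batch_grad)
  qed (use b \<open>scsg_draws M n _ _ _ T X0 I N J\<close> in auto)
  have K: "K = 2 * \<eta> * m0 / (\<Gamma> * real b * B0) * H"
    using \<open>0 < L\<close> by (simp add: K_def D\<^sub>H_def H_def)
  then have K_nonneg: "0 \<le> K"
    using \<Gamma> \<open>0 < \<eta>\<close> \<open>0 < m0\<close> \<open>0 < B0\<close> grad_second_moment_nonneg by (simp add: H_def)
  have \<rho>_nonneg: "0 \<le> \<rho> j" for j
    using \<Gamma> \<open>0 < \<eta>\<close> \<open>0 < m0\<close> \<alpha> by (simp add: \<rho>_def)
  have \<nu>_nonneg: "0 \<le> \<nu> j" for j
    using K_nonneg \<alpha> by (simp add: \<nu>_def)
  have pos: "0 < \<Lambda>\<^sub>1 j" "0 < \<Lambda>\<^sub>2 j" for j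
    using \<alpha> by (auto simp: \<Lambda>\<^sub>1_def \<Lambda>\<^sub>2_def rate_prod_pos)
  \<comment> \<open>Clipped iterates are measurable, and extended values admit an infinite second
    moment of the start.\<close>
  define V where "V j = (\<integral>\<^sup>+\<omega>. ennreal (lyapunov (\<rho> j) (clipped j \<omega>)) \<partial>M)" for j
  have lyapunov_measurable: "(\<lambda>x. ennreal (lyapunov (\<rho> j) x)) \<in> borel_measurable borel" for j
    using borel_measurable_lyapunov by measurable
  have V_Suc: "V (Suc j) \<le> ennreal (inverse (rate \<alpha> \<xi> T\<kappa> (Suc j))) * V j + ennreal (\<nu> (Suc j))"
    if j: "Suc j \<le> T" for j
  proof -
    let ?r = "inverse (rate \<alpha> \<xi> T\<kappa> (Suc j))"
    have r: "0 \<le> ?r"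
      using rate_pos[OF \<alpha>, of \<xi> T\<kappa> "Suc j"] by simp
    have kernel: "(\<integral>\<^sup>+z. ennreal (lyapunov (\<rho> (Suc j)) (epoch f \<eta> x z))
        \<partial>epoch_pmf n (nat \<lceil>min (B0 * \<alpha> ^ (2 * Suc j)) (real n)\<rceil>) b
          (m0 * \<alpha> ^ Suc j / (m0 * \<alpha> ^ Suc j + real b)))
        \<le> ennreal ?r * ennreal (lyapunov (\<rho> j) x) + ennreal (\<nu> (Suc j))" for x
    proof -
      have "\<rho> (Suc j) * (norm (x - xs))\<^sup>2 + 3 * \<Gamma> * (objective f n x - objective f n xs) \<le> ?r * lyapunov (\<rho> j) x"
        using lyapunov_contraction[OF \<alpha> \<open>0 < \<xi>\<close> \<open>\<xi> < 1\<close> \<open>0 < m0\<close> \<open>0 < \<eta>\<close> \<open>0 \<le> \<mu>\<close>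
            \<open>assumption_A2 f n xs \<mu>\<close>, where T\<kappa> = T\<kappa> and b = b and x = x and j = j, folded \<Gamma>_def, folded \<rho>_def] assms(23,24) m0
        by blast
      then have "ennreal (\<rho> (Suc j) * (norm (x - xs))\<^sup>2 + 3 * \<Gamma> * (objective f n x - objective f n xs) + \<nu> (Suc j))
          \<le> ennreal (?r * lyapunov (\<rho> j) x + \<nu> (Suc j))"
        by (intro ennreal_leI) simp
      also have "\<dots> = ennreal ?r * ennreal (lyapunov (\<rho> j) x) + ennreal (\<nu> (Suc j))"
        using r \<nu>_nonneg lyapunov_nonneg[OF \<rho>_nonneg] by (simp add: ennreal_plus ennreal_mult)
      finally show ?thesis
        using epoch_step[OF \<alpha> \<open>0 < m0\<close> \<open>0 < B0\<close> \<open>0 < \<eta>\<close> \<Gamma> b m0 step, of "Suc j" x]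
        unfolding \<nu>_def K H_def \<rho>_def by (rule order_trans[rotated])
    qed
    have "V (Suc j) \<le> (\<integral>\<^sup>+\<omega>. ennreal ?r * ennreal (lyapunov (\<rho> j) (clipped j \<omega>)) + ennreal (\<nu> (Suc j)) \<partial>M)"
      unfolding V_def epoch_law[OF j lyapunov_measurable] by (intro nn_integral_mono kernel)
    also have "\<dots> = ennreal ?r * V j + ennreal (\<nu> (Suc j))"
    proof -
      have "(\<lambda>\<omega>. ennreal (lyapunov (\<rho> j) (clipped j \<omega>))) \<in> borel_measurable M"
        using j by (intro measurable_compose[OF measurable_clipped_M lyapunov_measurable]) simp
      then show ?thesis
        by (simp add: V_def nn_integral_add nn_integral_cmult emeasure_space_1)
    qed
    finally show ?thesis .
  qed
  \<comment> \<open>The invariant counts noisy epochs: old noise shrinks at least by the tilde rate,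
    and a noisy epoch adds one to \<open>min (real j) Tn\<close>.\<close>
  have noise_Suc: "inverse (rate \<alpha> \<xi> T\<kappa> (Suc j)) * (inverse (\<Lambda>\<^sub>2 j) * K * min (real j) Tn) + \<nu> (Suc j)
      \<le> inverse (\<Lambda>\<^sub>2 (Suc j)) * K * min (real (Suc j)) Tn" for j
  proof -
    let ?r = "rate \<alpha> \<xi> T\<kappa> (Suc j)" and ?s = "rate \<alpha> \<xi> (max (ereal Tn) T\<kappa>) (Suc j)"
    have "?s \<le> ?r"
      using \<alpha> \<open>0 < \<xi>\<close> \<open>\<xi> < 1\<close> by (intro rate_antimono) auto
    then have "inverse ?r * inverse (\<Lambda>\<^sub>2 j) \<le> inverse ?s * inverse (\<Lambda>\<^sub>2 j)"
      using rate_pos[OF \<alpha>] pos(2)[of j] by (intro mult_right_mono le_imp_inverse_le) (auto simp: less_imp_le)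
    also have "\<dots> = inverse (\<Lambda>\<^sub>2 (Suc j))"
      by (simp add: \<Lambda>\<^sub>2_def rate_prod_Suc)
    finally have "inverse ?r * inverse (\<Lambda>\<^sub>2 j) * (K * min (real j) Tn)
        \<le> inverse (\<Lambda>\<^sub>2 (Suc j)) * (K * min (real j) Tn)"
      using K_nonneg \<open>0 < Tn\<close> by (intro mult_right_mono) auto
    then have "inverse ?r * (inverse (\<Lambda>\<^sub>2 j) * K * min (real j) Tn)
        \<le> inverse (\<Lambda>\<^sub>2 (Suc j)) * K * min (real j) Tn"
      by (simp add: mult_ac)
    moreover have "\<nu> (Suc j) \<le> inverse (\<Lambda>\<^sub>2 (Suc j)) * K * (min (real (Suc j)) Tn - min (real j) Tn)"
    proof (cases "B0 * \<alpha> ^ (2 * Suc j) < real n")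
      case True
      also have "real n = B0 * \<alpha> powr (2 * Tn)"
        using assms(26) by simp
      also have "\<alpha> ^ (2 * Suc j) = \<alpha> powr (2 * real (Suc j))"
        using powr_realpow[of \<alpha> "2 * Suc j"] \<alpha> by simp
      finally have "real (Suc j) < Tn"
        using \<open>0 < B0\<close> \<alpha> by simp
      \<comment> \<open>Since \<open>Suc j\<close> lies strictly below \<open>Tn\<close>, the
        minimum grows by a full one even for fractional \<open>Tn\<close>, and
        \<open>\<Lambda>\<^sub>2 (Suc j)\<close> is still \<open>\<alpha> ^ Suc j\<close>.\<close>
      then have "ereal (real (Suc j)) \<le> max (ereal Tn) T\<kappa>" "min (real (Suc j)) Tn - min (real j) Tn = 1"
        by (auto simp: le_max_iff_disj)
      then show ?thesis
        using True by (simp add: \<nu>_def \<Lambda>\<^sub>2_def rate_prod_initial divide_inverse mult.commute del: power_Suc)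
    next
      case False
      have "0 \<le> inverse (\<Lambda>\<^sub>2 (Suc j)) * K * (min (real (Suc j)) Tn - min (real j) Tn)"
        using pos(2)[of "Suc j"] K_nonneg by (intro mult_nonneg_nonneg) auto
      then show ?thesis
        using False by (simp add: \<nu>_def)
    qed
    ultimately show ?thesis
      by (simp add: right_diff_distrib)
  qed
  have V_le: "V j \<le> ennreal (inverse (\<Lambda>\<^sub>1 j)) * V 0 + ennreal (inverse (\<Lambda>\<^sub>2 j) * K * min (real j) Tn)"
    if "j \<le> T" for j
    using that
  proof (induction j)
    case 0
    then show ?case
      by (simp add: \<Lambda>\<^sub>1_def rate_prod_def)
  next
    case (Suc j)
    let ?r = "inverse (rate \<alpha> \<xi> T\<kappa> (Suc j))"
    let ?e = "inverse (\<Lambda>\<^sub>2 j) * K * min (real j) Tn"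
    have r: "0 \<le> ?r"
      using rate_pos[OF \<alpha>, of \<xi> T\<kappa> "Suc j"] by simp
    have e: "0 \<le> ?e"
      using pos(2)[of j] K_nonneg \<open>0 < Tn\<close> by simp
    have "V (Suc j) \<le> ennreal ?r * V j + ennreal (\<nu> (Suc j))"
      using Suc.prems by (rule V_Suc)
    also have "\<dots> \<le> ennreal ?r * (ennreal (inverse (\<Lambda>\<^sub>1 j)) * V 0 + ennreal ?e) + ennreal (\<nu> (Suc j))"
      using Suc by (intro add_right_mono mult_left_mono) auto
    also have "\<dots> = ennreal (?r * inverse (\<Lambda>\<^sub>1 j)) * V 0 + ennreal (?r * ?e + \<nu> (Suc j))"
      using r e \<nu>_nonneg pos(1)[of j] by (simp add: distrib_left ennreal_mult ennreal_plus mult.assoc add.assoc)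
    also have "?r * inverse (\<Lambda>\<^sub>1 j) = inverse (\<Lambda>\<^sub>1 (Suc j))"
      by (simp add: \<Lambda>\<^sub>1_def rate_prod_Suc)
    also have "ennreal (?r * ?e + \<nu> (Suc j)) \<le> ennreal (inverse (\<Lambda>\<^sub>2 (Suc j)) * K * min (real (Suc j)) Tn)"
      by (intro ennreal_leI noise_Suc)
    finally show ?case
      by (simp add: add_left_mono)
  qed
  \<comment> \<open>Index 0 stands before the first epoch. Smoothness bounds the gap by the squared
    distance, and the total factor is \<open>\<eta> * L + (1 - \<Gamma>) * (real b / m0)\<close>, at
    most \<open>(1 - \<Gamma>) / 2 + \<Gamma>\<close> and hence at most 1.\<close>
  have "lyapunov (\<rho> 0) x \<le> inverse (2 * \<eta>) * (norm (x - xs))\<^sup>2" for x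
  proof -
    have "lyapunov (\<rho> 0) x \<le> L / 2 * (norm (x - xs))\<^sup>2 + \<rho> 0 * (norm (x - xs))\<^sup>2"
      using objective_gap_le[of x] by (simp add: lyapunov_def)
    also have "\<dots> = inverse (2 * \<eta>) * ((\<eta> * L + (1 - \<Gamma>) * (real b / m0)) * (norm (x - xs))\<^sup>2)"
      using \<open>0 < \<eta>\<close> \<open>0 < m0\<close> by (simp add: \<rho>_def field_simps)
    also have "\<dots> \<le> inverse (2 * \<eta>) * (1 * (norm (x - xs))\<^sup>2)"
    proof (intro mult_left_mono mult_right_mono)
      have "(1 - \<Gamma>) * (real b / m0) \<le> 1 * \<Gamma>"
        using \<Gamma> m0 \<open>0 < m0\<close> by (intro mult_mono) auto
      then show "\<eta> * L + (1 - \<Gamma>) * (real b / m0) \<le> 1"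
        using step(1) \<Gamma> by linarith
    qed (use \<open>0 < \<eta>\<close> in auto)
    finally show ?thesis by simp
  qed
  then have "V 0 \<le> (\<integral>\<^sup>+\<omega>. ennreal (inverse (2 * \<eta>) * (norm (X0 \<omega> - xs))\<^sup>2) \<partial>M)"
    unfolding V_def by (intro nn_integral_mono ennreal_leI) (simp add: clipped_def)
  also have "\<dots> = ennreal (inverse (2 * \<eta>)) * (\<integral>\<^sup>+\<omega>. ennreal ((norm (X0 \<omega> - xs))\<^sup>2) \<partial>M)"
  proof -
    have [measurable]: "X0 \<in> borel_measurable M"
      using \<open>scsg_draws M n _ _ _ T X0 I N J\<close> by (simp add: scsg_draws_def)
    have "ennreal (inverse (2 * \<eta>) * (norm (X0 \<omega> - xs))\<^sup>2)
        = ennreal (inverse (2 * \<eta>)) * ennreal ((norm (X0 \<omega> - xs))\<^sup>2)" for \<omega>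
      using \<open>0 < \<eta>\<close> by (intro ennreal_mult) auto
    then show ?thesis
      by (simp only:) (rule nn_integral_cmult, measurable)
  qed
  also have "\<dots> = D\<^sub>x / ennreal (2 * \<eta> * L)"
  proof -
    have "inverse (2 * \<eta>) = L * inverse (2 * \<eta> * L)"
      using \<open>0 < L\<close> by simp
    then have "ennreal (inverse (2 * \<eta>)) = ennreal (L * inverse (2 * \<eta> * L))"
      by (rule arg_cong)
    also have "\<dots> = ennreal L * ennreal (inverse (2 * \<eta> * L))"
      using \<open>0 < L\<close> \<open>0 < \<eta>\<close> by (intro ennreal_mult) auto
    also have "ennreal (inverse (2 * \<eta> * L)) = inverse (ennreal (2 * \<eta> * L))"
      using \<open>0 < L\<close> \<open>0 < \<eta>\<close> by (intro inverse_ennreal[symmetric]) auto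
    finally have "ennreal (inverse (2 * \<eta>)) = ennreal L * inverse (ennreal (2 * \<eta> * L))" .
    then show ?thesis
      by (simp add: D\<^sub>x_def divide_ennreal_def mult_ac)
  qed
  finally have V_0: "V 0 \<le> D\<^sub>x / ennreal (2 * \<eta> * L)" .
  \<comment> \<open>Only after the last epoch is the distance part of the Lyapunov function
    discarded.\<close>
  have "(\<integral>\<^sup>+\<omega>. ennreal (F (XT \<omega>) - F xs) \<partial>M) \<le> (\<integral>\<^sup>+\<omega>. ennreal (lyapunov (\<rho> T) (iterate T \<omega>)) \<partial>M)"
    using \<rho>_nonneg by (intro nn_integral_mono ennreal_leI) (simp add: F_def XT_def iterate_def lyapunov_def)
  also have "\<dots> = V T"
    unfolding V_def by (intro nn_integral_iterate) simp
  also have "\<dots> \<le> ennreal (inverse (\<Lambda>\<^sub>1 T)) * V 0 + ennreal (inverse (\<Lambda>\<^sub>2 T) * K * min (real T) Tn)"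
    by (rule V_le) simp
  also have "\<dots> \<le> ennreal (inverse (\<Lambda>\<^sub>1 T)) * (D\<^sub>x / ennreal (2 * \<eta> * L))
      + ennreal (inverse (\<Lambda>\<^sub>2 T) * K * min (real T) Tn)"
    by (intro add_right_mono mult_left_mono V_0) simp
  finally show ?thesis
    by (simp add: K_def \<Lambda>_def \<Lambda>'_def \<Lambda>\<^sub>1_def \<Lambda>\<^sub>2_def mult.assoc)
qed

end
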